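(* Let $E$ and $F$ be finite graphs with no sinks, and let $K$ be any field. If $X_E$ is conjugate to $X_F$, then $L_K(E)$ is isomorphic to $L_K(F)$.
   Context: A finite graph $E=(E^0,E^1,r,s)$ consists of finite sets $E^0$ (vertices), $E^1$ (edges) and range and source maps $r,s:E^1\to E^0$. A vertex $v$ is a sink if $s^{-1}(v)=\emptyset$. For a finite graph with no sinks, the edge shift is $X_E=E^\infty=\{e_1e_2\ldots\in(E^1)^{\mathbb{N}}:r(e_i)=s(e_{i+1})\text{ for all }i\}$, with the subspace topology of the product topology on $(E^1)^{\mathbb{N}}$ ($E^1$ discrete), and shift map $\sigma(e_1e_2e_3\ldots)=e_2e_3\ldots$. $X_E$ is conjugate to $X_F$ if there is a continuous bijection $\phi:X_E\to X_F$ with $\phi\circ\sigma=\sigma\circ\phi$. For a field $K$, the Leavitt path algebra $L_K(E)$ is the universal $K$-algebra generated by a set $\{v:v\in E^0\}$ of pairwise orthogonal idempotents together with a set $\{e,e^*:e\in E^1\}$ satisfying: (1) $s(e)e=er(e)=e$ for all $e\in E^1$; (2) $r(e)e^*=e^*s(e)=e^*$ for all $e\in E^1$; (3) $e^*f=\delta_{e,f}\,r(e)$ for all $e,f\in E^1$; (4) $v=\sum_{\{e\in E^1:s(e)=v\}}ee^*$ whenever $0<|s^{-1}(v)|<\infty$. *)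

theory Defs
  imports
    "HOL-Analysis.Analysis"
    "HOL-Library.Poly_Mapping"
    "Graph_Theory.Digraph"
begin

section \<open>Edge shifts\<close>

text \<open>
  A graph $(E^0, E^1, r, s)$ is a \<^typ>\<open>('v, 'e) pre_digraph\<close> with vertices \<^const>\<open>verts\<close>,
  edges \<^const>\<open>arcs\<close>, range map \<^const>\<open>head\<close> and source map \<^const>\<open>tail\<close>.  Loops, parallel
  edges and the empty graph are allowed by \<^locale>\<open>fin_digraph\<close>.
\<close>

definition is_sink :: "('v, 'e) pre_digraph \<Rightarrow> 'v \<Rightarrow> bool" where
  "is_sink E v \<longleftrightarrow> v \<in> verts E \<and> out_arcs E v = {}"

definition no_sinks :: "('v, 'e) pre_digraph \<Rightarrow> bool" where
  "no_sinks E \<longleftrightarrow> (\<forall>v \<in> verts E. \<not> is_sink E v)"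

definition edge_shift :: "('v, 'e) pre_digraph \<Rightarrow> (nat \<Rightarrow> 'e) set" where
  "edge_shift E = {x. (\<forall>i. x i \<in> arcs E) \<and> (\<forall>i. head E (x i) = tail E (x (Suc i)))}"

definition edge_shift_topology :: "('v, 'e) pre_digraph \<Rightarrow> (nat \<Rightarrow> 'e) topology" where
  "edge_shift_topology E =
     subtopology (product_topology (\<lambda>_. discrete_topology (arcs E)) UNIV) (edge_shift E)"

definition shift_map :: "(nat \<Rightarrow> 'e) \<Rightarrow> (nat \<Rightarrow> 'e)" where
  "shift_map x = (\<lambda>i. x (Suc i))"

definition edge_shifts_conjugate :: "('v, 'e) pre_digraph \<Rightarrow> ('w, 'f) pre_digraph \<Rightarrow> bool" where
  "edge_shifts_conjugate E F \<longleftrightarrow>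
     (\<exists>\<phi>. continuous_map (edge_shift_topology E) (edge_shift_topology F) \<phi> \<and>
          bij_betw \<phi> (edge_shift E) (edge_shift F) \<and>
          (\<forall>x \<in> edge_shift E. \<phi> (shift_map x) = shift_map (\<phi> x)))"


section \<open>Algebras given by generators and relations\<close>

text \<open>
  Algebras are associative, but neither commutative nor required to have a unit; a homomorphism
  preserves addition, multiplication and scalar multiplication.
\<close>

record ('k, 'a) kalgebra =
  alg_carrier :: "'a set"
  alg_add :: "'a \<Rightarrow> 'a \<Rightarrow> 'a"
  alg_mult :: "'a \<Rightarrow> 'a \<Rightarrow> 'a"
  alg_scale :: "'k \<Rightarrow> 'a \<Rightarrow> 'a"

definition kalgebra_iso :: "('k, 'a) kalgebra \<Rightarrow> ('k, 'b) kalgebra \<Rightarrow> ('a \<Rightarrow> 'b) \<Rightarrow> bool" where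
  "kalgebra_iso A B h \<longleftrightarrow>
     bij_betw h (alg_carrier A) (alg_carrier B) \<and>
     (\<forall>x \<in> alg_carrier A. \<forall>y \<in> alg_carrier A. h (alg_add A x y) = alg_add B (h x) (h y)) \<and>
     (\<forall>x \<in> alg_carrier A. \<forall>y \<in> alg_carrier A. h (alg_mult A x y) = alg_mult B (h x) (h y)) \<and>
     (\<forall>c. \<forall>x \<in> alg_carrier A. h (alg_scale A c x) = alg_scale B c (h x))"

definition kalgebras_isomorphic :: "('k, 'a) kalgebra \<Rightarrow> ('k, 'b) kalgebra \<Rightarrow> bool" where
  "kalgebras_isomorphic A B \<longleftrightarrow> (\<exists>h. kalgebra_iso A B h)"

text \<open>
  Words over an alphabet form a monoid under concatenation.  With this instance, the type
  \<^typ>\<open>'x list \<Rightarrow>\<^sub>0 'k\<close> with its library ring structure is the free unital associative algebra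
  over \<^typ>\<open>'x\<close>.
\<close>

instantiation list :: (type) monoid_add
begin

definition zero_list :: "'a list" where "zero_list = []"

definition plus_list :: "'a list \<Rightarrow> 'a list \<Rightarrow> 'a list" where "plus_list xs ys = xs @ ys"

instance by standard (simp_all add: zero_list_def plus_list_def)

end

definition gen :: "'x \<Rightarrow> ('x list \<Rightarrow>\<^sub>0 'k::field)" where
  "gen x = Poly_Mapping.single [x] 1"

definition pm_scale :: "'k::field \<Rightarrow> ('x list \<Rightarrow>\<^sub>0 'k) \<Rightarrow> ('x list \<Rightarrow>\<^sub>0 'k)" where
  "pm_scale c p = Poly_Mapping.map ((*) c) p"

text \<open>
  The free algebra on \<open>X\<close> among algebras not required to have a unit: only nonempty words occur.
\<close>

definition free_algebra :: "'x set \<Rightarrow> ('x list \<Rightarrow>\<^sub>0 'k::field) set" where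
  "free_algebra X = {p. \<forall>w \<in> Poly_Mapping.keys p. w \<noteq> [] \<and> set w \<subseteq> X}"

inductive_set generated_ideal ::
  "'x set \<Rightarrow> ('x list \<Rightarrow>\<^sub>0 'k::field) set \<Rightarrow> ('x list \<Rightarrow>\<^sub>0 'k) set"
  for X :: "'x set" and R :: "('x list \<Rightarrow>\<^sub>0 'k) set"
where
  ideal_base: "p \<in> R \<Longrightarrow> p \<in> generated_ideal X R"
| ideal_zero: "0 \<in> generated_ideal X R"
| ideal_add: "p \<in> generated_ideal X R \<Longrightarrow> q \<in> generated_ideal X R \<Longrightarrow> p + q \<in> generated_ideal X R"
| ideal_scale: "p \<in> generated_ideal X R \<Longrightarrow> pm_scale c p \<in> generated_ideal X R"
| ideal_left: "a \<in> free_algebra X \<Longrightarrow> p \<in> generated_ideal X R \<Longrightarrow> a * p \<in> generated_ideal X R"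
| ideal_right: "a \<in> free_algebra X \<Longrightarrow> p \<in> generated_ideal X R \<Longrightarrow> p * a \<in> generated_ideal X R"

definition relation_cong ::
  "'x set \<Rightarrow> ('x list \<Rightarrow>\<^sub>0 'k::field) set \<Rightarrow> (('x list \<Rightarrow>\<^sub>0 'k) \<times> ('x list \<Rightarrow>\<^sub>0 'k)) set" where
  "relation_cong X R =
     {(p, q). p \<in> free_algebra X \<and> q \<in> free_algebra X \<and> p - q \<in> generated_ideal X R}"

text \<open>
  The universal algebra generated by \<open>X\<close> subject to the relations \<open>p = 0\<close> for \<open>p \<in> R\<close>, where
  \<open>R \<subseteq> free_algebra X\<close>: the quotient of the free algebra by the two-sided ideal generated by \<open>R\<close>.
\<close>

definition presented_algebra ::
  "'x set \<Rightarrow> ('x list \<Rightarrow>\<^sub>0 'k::field) set \<Rightarrow> ('k, ('x list \<Rightarrow>\<^sub>0 'k) set) kalgebra" where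
  "presented_algebra X R =
    (let \<theta> = relation_cong X R in
     \<lparr> alg_carrier = free_algebra X // \<theta>,
       alg_add = (\<lambda>A B. \<Union>p \<in> A. \<Union>q \<in> B. \<theta> `` {p + q}),
       alg_mult = (\<lambda>A B. \<Union>p \<in> A. \<Union>q \<in> B. \<theta> `` {p * q}),
       alg_scale = (\<lambda>c A. \<Union>p \<in> A. \<theta> `` {pm_scale c p}) \<rparr>)"


section \<open>Leavitt path algebras\<close>

datatype ('v, 'e) leavitt_gen = Vertex 'v | Edge 'e | Ghost 'e

definition leavitt_gens :: "('v, 'e) pre_digraph \<Rightarrow> ('v, 'e) leavitt_gen set" where
  "leavitt_gens E = Vertex ` verts E \<union> Edge ` arcs E \<union> Ghost ` arcs E"

text \<open>An equation \<open>p = q\<close> between generators is recorded as the relator \<open>p - q\<close>.\<close>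

inductive_set leavitt_relations ::
  "('v, 'e) pre_digraph \<Rightarrow> (('v, 'e) leavitt_gen list \<Rightarrow>\<^sub>0 'k::field) set"
  for E :: "('v, 'e) pre_digraph"
where
  vertex_idempotent: "v \<in> verts E \<Longrightarrow>
    gen (Vertex v) * gen (Vertex v) - gen (Vertex v) \<in> leavitt_relations E"
| vertex_orthogonal: "v \<in> verts E \<Longrightarrow> w \<in> verts E \<Longrightarrow> v \<noteq> w \<Longrightarrow>
    gen (Vertex v) * gen (Vertex w) \<in> leavitt_relations E"
| source_edge: "e \<in> arcs E \<Longrightarrow>
    gen (Vertex (tail E e)) * gen (Edge e) - gen (Edge e) \<in> leavitt_relations E"
| edge_range: "e \<in> arcs E \<Longrightarrow>
    gen (Edge e) * gen (Vertex (head E e)) - gen (Edge e) \<in> leavitt_relations E"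
| range_ghost: "e \<in> arcs E \<Longrightarrow>
    gen (Vertex (head E e)) * gen (Ghost e) - gen (Ghost e) \<in> leavitt_relations E"
| ghost_source: "e \<in> arcs E \<Longrightarrow>
    gen (Ghost e) * gen (Vertex (tail E e)) - gen (Ghost e) \<in> leavitt_relations E"
| ghost_edge_same: "e \<in> arcs E \<Longrightarrow>
    gen (Ghost e) * gen (Edge e) - gen (Vertex (head E e)) \<in> leavitt_relations E"
| ghost_edge_distinct: "e \<in> arcs E \<Longrightarrow> f \<in> arcs E \<Longrightarrow> e \<noteq> f \<Longrightarrow>
    gen (Ghost e) * gen (Edge f) \<in> leavitt_relations E"
| vertex_sum: "v \<in> verts E \<Longrightarrow> out_arcs E v \<noteq> {} \<Longrightarrow> finite (out_arcs E v) \<Longrightarrow>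
    gen (Vertex v) - (\<Sum>e \<in> out_arcs E v. gen (Edge e) * gen (Ghost e)) \<in> leavitt_relations E"

definition leavitt_path_algebra ::
  "('v, 'e) pre_digraph \<Rightarrow> ('k::field, (('v, 'e) leavitt_gen list \<Rightarrow>\<^sub>0 'k) set) kalgebra" where
  "leavitt_path_algebra E = presented_algebra (leavitt_gens E) (leavitt_relations E)"

end

theory Submission
  imports Defs
begin

text \<open>
  Let \<open>T\<close> be the sum of all edges and \<open>T'\<close> the sum of all ghost edges of \<open>F\<close>, and for a clopen
  set \<open>U\<close> of the edge shift let \<open>1\<^sub>U\<close> be the sum of the idempotents \<open>\<mu>\<mu>\<^sup>*\<close> over the paths \<open>\<mu>\<close> of a
  large fixed length whose cylinders lie in \<open>U\<close>.  The products of \<open>T\<close>, \<open>T'\<close> and the \<open>1\<^sub>U\<close> obey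
  relations which only involve the shift map, and the generators are recovered from them: an edge
  \<open>e\<close> is \<open>1\<^bsub>Z(e)\<^esub> T\<close>, its ghost is \<open>T' 1\<^bsub>Z(e)\<^esub>\<close>, and a vertex \<open>v\<close> is \<open>1\<^bsub>Z(v)\<^esub>\<close>.
  Hence a conjugacy \<open>\<phi>\<close> from \<open>E\<close> to \<open>F\<close> yields a Leavitt family for \<open>E\<close> inside the algebra of \<open>F\<close>, namely
  \<open>1\<^bsub>\<phi>(Z(e))\<^esub> T\<close>, \<open>T' 1\<^bsub>\<phi>(Z(e))\<^esub>\<close> and \<open>1\<^bsub>\<phi>(Z(v))\<^esub>\<close>.  The homomorphism so defined sends \<open>1\<^sub>U\<close> to
  \<open>1\<^bsub>\<phi>(U)\<^esub>\<close>, \<open>T\<close> to \<open>T\<close> and \<open>T'\<close> to \<open>T'\<close>, so the one obtained from the inverse conjugacy is its inverse.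
\<close>

section \<open>Edge shifts\<close>

lemma edge_shift_shift_map: "x \<in> edge_shift E \<Longrightarrow> shift_map x \<in> edge_shift E"
  by (auto simp: edge_shift_def shift_map_def)

lemma case_nat_in_edge_shift:
  assumes "e \<in> arcs E" "x \<in> edge_shift E" "head E e = tail E (x 0)"
  shows "case_nat e x \<in> edge_shift E"
  using assms by (auto simp: edge_shift_def split: nat.splits)

lemma shift_map_case_nat [simp]: "shift_map (case_nat e x) = x"
  by (simp add: shift_map_def)

lemma edge_shift_first:
  assumes "x \<in> edge_shift E"
  shows "x 0 \<in> arcs E" "head E (x 0) = tail E (shift_map x 0)"
  using assms by (auto simp: edge_shift_def shift_map_def)

lemma no_sinks_iff: "no_sinks E \<longleftrightarrow> (\<forall>v\<in>verts E. \<exists>e\<in>arcs E. tail E e = v)"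
  by (auto simp: no_sinks_def is_sink_def out_arcs_def)

text \<open>This is how the absence of sinks enters: a walk can always be continued, so by dependent
  choice the cylinders of vertices, and then of edges, are nonempty.\<close>

lemma (in fin_digraph) edge_shift_from_vertex:
  assumes "no_sinks G" "v \<in> verts G"
  obtains x where "x \<in> edge_shift G" "tail G (x 0) = v"
proof -
  have "\<exists>x. \<forall>n. (x n \<in> arcs G \<and> (n = 0 \<longrightarrow> tail G (x n) = v)) \<and> head G (x n) = tail G (x (Suc n))"
  proof (rule dependent_nat_choice)
    show "\<exists>e. e \<in> arcs G \<and> (0 = (0::nat) \<longrightarrow> tail G e = v)"
      using assms by (auto simp: no_sinks_iff)
    show "\<exists>f. (f \<in> arcs G \<and> (Suc n = 0 \<longrightarrow> tail G f = v)) \<and> head G e = tail G f"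
      if "e \<in> arcs G \<and> (n = 0 \<longrightarrow> tail G e = v)" for e n
      using that assms(1) head_in_verts[of e] unfolding no_sinks_iff by fastforce
  qed
  then show thesis using that by (auto simp: edge_shift_def)
qed

section \<open>Prefixes, cylinders and cylindrical sets\<close>

definition edge_prefix :: "nat \<Rightarrow> (nat \<Rightarrow> 'e) \<Rightarrow> 'e list" where
  "edge_prefix n x = map x [0..<n]"

lemma length_edge_prefix [simp]: "length (edge_prefix n x) = n"
  by (simp add: edge_prefix_def)

lemma edge_prefix_0 [simp]: "edge_prefix 0 x = []"
  by (simp add: edge_prefix_def)

lemma edge_prefix_Suc: "edge_prefix (Suc n) x = edge_prefix n x @ [x n]"
  by (simp add: edge_prefix_def)

lemma edge_prefix_Suc_shift: "edge_prefix (Suc n) x = x 0 # edge_prefix n (shift_map x)"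
  unfolding edge_prefix_def shift_map_def by (subst map_upt_Suc) simp

lemma edge_prefix_eq_iff: "edge_prefix n x = edge_prefix n y \<longleftrightarrow> (\<forall>i<n. x i = y i)"
  by (auto simp: edge_prefix_def)

lemma set_edge_prefix: "x \<in> edge_shift E \<Longrightarrow> set (edge_prefix n x) \<subseteq> arcs E"
  by (auto simp: edge_prefix_def edge_shift_def)

text \<open>These are the unions of cylinders over paths of length \<open>n\<close>. At level 0 only
  the empty set and the whole shift qualify.\<close>

definition determined :: "('v, 'e) pre_digraph \<Rightarrow> nat \<Rightarrow> (nat \<Rightarrow> 'e) set \<Rightarrow> bool" where
  "determined E n U \<longleftrightarrow> U \<subseteq> edge_shift E \<and>
     (\<forall>x\<in>U. \<forall>y\<in>edge_shift E. edge_prefix n x = edge_prefix n y \<longrightarrow> y \<in> U)"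

text \<open>The finitary form of being clopen, by \<open>cylindrical_iff_clopen\<close>.\<close>

definition cylindrical :: "('v, 'e) pre_digraph \<Rightarrow> (nat \<Rightarrow> 'e) set \<Rightarrow> bool" where
  "cylindrical E U \<longleftrightarrow> (\<exists>n. determined E n U)"

definition edge_cylinder :: "('v, 'e) pre_digraph \<Rightarrow> 'e \<Rightarrow> (nat \<Rightarrow> 'e) set" where
  "edge_cylinder E e = {x \<in> edge_shift E. x 0 = e}"

definition vertex_cylinder :: "('v, 'e) pre_digraph \<Rightarrow> 'v \<Rightarrow> (nat \<Rightarrow> 'e) set" where
  "vertex_cylinder E v = {x \<in> edge_shift E. tail E (x 0) = v}"

definition shift_preimage :: "('v, 'e) pre_digraph \<Rightarrow> (nat \<Rightarrow> 'e) set \<Rightarrow> (nat \<Rightarrow> 'e) set" where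
  "shift_preimage E U = {x \<in> edge_shift E. shift_map x \<in> U}"

lemma determinedD:
  "determined E n U \<Longrightarrow> x \<in> U \<Longrightarrow> y \<in> edge_shift E \<Longrightarrow> edge_prefix n x = edge_prefix n y \<Longrightarrow> y \<in> U"
  by (auto simp: determined_def)

lemma determined_subset: "determined E n U \<Longrightarrow> U \<subseteq> edge_shift E"
  by (simp add: determined_def)

lemma determined_mono: "determined E m U \<Longrightarrow> m \<le> n \<Longrightarrow> determined E n U"
  unfolding determined_def edge_prefix_eq_iff by (meson order_less_le_trans)

lemma cylindrical_subset: "cylindrical E U \<Longrightarrow> U \<subseteq> edge_shift E"
  by (auto simp: cylindrical_def determined_def)

lemma cylindrical_common_level:
  assumes "cylindrical E U" "cylindrical E V"
  obtains n where "determined E n U" "determined E n V"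
  using assms unfolding cylindrical_def by (meson determined_mono max.cobounded1 max.cobounded2)

lemma cylindrical_empty [simp]: "cylindrical E {}"
  by (simp add: cylindrical_def determined_def)

lemma determined_Un: "determined E n U \<Longrightarrow> determined E n V \<Longrightarrow> determined E n (U \<union> V)"
  unfolding determined_def by blast

lemma determined_Int: "determined E n U \<Longrightarrow> determined E n V \<Longrightarrow> determined E n (U \<inter> V)"
  unfolding determined_def by blast

lemma cylindrical_Un: "cylindrical E U \<Longrightarrow> cylindrical E V \<Longrightarrow> cylindrical E (U \<union> V)"
  by (erule (1) cylindrical_common_level) (metis determined_Un cylindrical_def)

lemma cylindrical_Int: "cylindrical E U \<Longrightarrow> cylindrical E V \<Longrightarrow> cylindrical E (U \<inter> V)"
  by (erule (1) cylindrical_common_level) (metis determined_Int cylindrical_def)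

lemma cylindrical_UN:
  "finite I \<Longrightarrow> (\<And>i. i \<in> I \<Longrightarrow> cylindrical E (U i)) \<Longrightarrow> cylindrical E (\<Union>i\<in>I. U i)"
  by (induction I rule: finite_induct) (auto intro: cylindrical_Un)

lemma determined_shift_preimage:
  "determined E n U \<Longrightarrow> determined E (Suc n) (shift_preimage E U)"
  by (auto simp: determined_def shift_preimage_def edge_prefix_Suc_shift edge_shift_shift_map)

lemma cylindrical_shift_preimage: "cylindrical E U \<Longrightarrow> cylindrical E (shift_preimage E U)"
  using determined_shift_preimage unfolding cylindrical_def by blast

lemma determined_first: "determined E (Suc 0) {x \<in> edge_shift E. P (x 0)}"
  by (auto simp: determined_def edge_prefix_eq_iff)

lemma cylindrical_edge_cylinder [simp]: "cylindrical E (edge_cylinder E e)"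
  unfolding cylindrical_def edge_cylinder_def using determined_first[of E "\<lambda>f. f = e"] by blast

lemma cylindrical_vertex_cylinder [simp]: "cylindrical E (vertex_cylinder E v)"
  unfolding cylindrical_def vertex_cylinder_def using determined_first[of E "\<lambda>e. tail E e = v"] by blast

lemma vertex_cylinder_eq_UN:
  "vertex_cylinder E v = (\<Union>e\<in>out_arcs E v. edge_cylinder E e)"
  by (auto simp: vertex_cylinder_def edge_cylinder_def dest: edge_shift_first)

lemma edge_shift_eq_UN: "edge_shift E = (\<Union>e\<in>arcs E. edge_cylinder E e)"
  by (auto simp: edge_cylinder_def dest: edge_shift_first)

lemma inj_on_shift_edge_cylinder: "inj_on shift_map (edge_cylinder E e)"
proof (rule inj_onI, rule ext)
  fix x y i
  assume "x \<in> edge_cylinder E e" "y \<in> edge_cylinder E e" "shift_map x = shift_map y"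
  then show "x i = y i"
    by (cases i) (auto simp: edge_cylinder_def shift_map_def fun_eq_iff)
qed

text \<open>Prepending \<open>e\<close> inverts the shift. This is the dynamical form of the
  relation that a ghost times its own edge is the range vertex.\<close>

lemma shift_edge_cylinder:
  assumes "e \<in> arcs E"
  shows "shift_map ` edge_cylinder E e = vertex_cylinder E (head E e)"
proof
  show "shift_map ` edge_cylinder E e \<subseteq> vertex_cylinder E (head E e)"
    by (auto simp: edge_cylinder_def vertex_cylinder_def edge_shift_shift_map dest: edge_shift_first)
  show "vertex_cylinder E (head E e) \<subseteq> shift_map ` edge_cylinder E e"
  proof
    fix x assume "x \<in> vertex_cylinder E (head E e)"
    then have "case_nat e x \<in> edge_cylinder E e"
      using assms by (auto simp: edge_cylinder_def vertex_cylinder_def intro: case_nat_in_edge_shift)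
    then show "x \<in> shift_map ` edge_cylinder E e" by force
  qed
qed

text \<open>A point \<open>y\<close> agreeing with \<open>shift_map u\<close> on at least one edge
  starts with the same edge, so the first edge of \<open>u\<close> may be put in front of it. The
  level drops by one, and it stays positive for this reason.\<close>

lemma determined_shift_image:
  assumes "determined E (Suc (Suc n)) U"
  shows "determined E (Suc n) (shift_map ` U)"
  unfolding determined_def
proof (intro conjI ballI impI)
  show "shift_map ` U \<subseteq> edge_shift E"
    using determined_subset[OF assms] edge_shift_shift_map by blast
next
  fix x y assume "x \<in> shift_map ` U" and y: "y \<in> edge_shift E"
    and eq: "edge_prefix (Suc n) x = edge_prefix (Suc n) y"
  then obtain u where u: "u \<in> U" "x = shift_map u" by blast
  have "u \<in> edge_shift E" using u determined_subset[OF assms] by blast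
  moreover have "y 0 = x 0" using eq by (simp add: edge_prefix_Suc_shift)
  ultimately have "case_nat (u 0) y \<in> edge_shift E"
    using y u(2) by (auto intro!: case_nat_in_edge_shift dest: edge_shift_first)
  then have "case_nat (u 0) y \<in> U"
    using determinedD[OF assms u(1)] eq u(2) by (simp add: edge_prefix_Suc_shift[of "Suc n"])
  then show "y \<in> shift_map ` U" by force
qed

section \<open>Leavitt families\<close>

text \<open>For a path \<open>w\<close> this is \<open>w\<close> times its ghost. The class
  \<open>ring\<close> provides no \<open>1\<close>, so the empty word gets the sum of all vertices,
  which acts as a unit on the generators.\<close>

primrec path_idem ::
  "('v, 'e) pre_digraph \<Rightarrow> (('v, 'e) leavitt_gen \<Rightarrow> 'a::ring) \<Rightarrow> 'e list \<Rightarrow> 'a" where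
  "path_idem E g [] = (\<Sum>v\<in>verts E. g (Vertex v))"
| "path_idem E g (e # w) = g (Edge e) * path_idem E g w * g (Ghost e)"

text \<open>
  For a cylindrical set \<open>U\<close> this is the element \<open>1\<^sub>U\<close> of the diagonal subalgebra; by
  \<open>leavitt_family.cylinder_idem_eq\<close> every level determining \<open>U\<close> gives the same value.
\<close>

definition cylinder_idem ::
  "('v, 'e) pre_digraph \<Rightarrow> (('v, 'e) leavitt_gen \<Rightarrow> 'a::ring) \<Rightarrow> (nat \<Rightarrow> 'e) set \<Rightarrow> 'a" where
  "cylinder_idem E g U = (\<Sum>w\<in>edge_prefix (LEAST n. determined E n U) ` U. path_idem E g w)"

definition edge_sum :: "('v, 'e) pre_digraph \<Rightarrow> (('v, 'e) leavitt_gen \<Rightarrow> 'a::ring) \<Rightarrow> 'a" where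
  "edge_sum E g = (\<Sum>e\<in>arcs E. g (Edge e))"

definition ghost_sum :: "('v, 'e) pre_digraph \<Rightarrow> (('v, 'e) leavitt_gen \<Rightarrow> 'a::ring) \<Rightarrow> 'a" where
  "ghost_sum E g = (\<Sum>e\<in>arcs E. g (Ghost e))"

text \<open>As there are no sinks and finitely many edges, \<open>vertex_sum\<close> can be stated
  at every vertex. The target is any ring, so the same calculations serve different
  quotients.\<close>

locale leavitt_family = fin_digraph E
  for E :: "('v, 'e) pre_digraph" and g :: "('v, 'e) leavitt_gen \<Rightarrow> 'a::ring" +
  assumes no_sinks: "no_sinks E"
    and vertex_vertex: "v \<in> verts E \<Longrightarrow> w \<in> verts E \<Longrightarrow>
      g (Vertex v) * g (Vertex w) = (if v = w then g (Vertex v) else 0)"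
    and vertex_edge: "e \<in> arcs E \<Longrightarrow> g (Vertex (tail E e)) * g (Edge e) = g (Edge e)"
    and edge_vertex: "e \<in> arcs E \<Longrightarrow> g (Edge e) * g (Vertex (head E e)) = g (Edge e)"
    and vertex_ghost: "e \<in> arcs E \<Longrightarrow> g (Vertex (head E e)) * g (Ghost e) = g (Ghost e)"
    and ghost_vertex: "e \<in> arcs E \<Longrightarrow> g (Ghost e) * g (Vertex (tail E e)) = g (Ghost e)"
    and ghost_edge: "e \<in> arcs E \<Longrightarrow> f \<in> arcs E \<Longrightarrow>
      g (Ghost e) * g (Edge f) = (if e = f then g (Vertex (head E e)) else 0)"
    and vertex_sum: "v \<in> verts E \<Longrightarrow>
      g (Vertex v) = (\<Sum>e\<in>out_arcs E v. g (Edge e) * g (Ghost e))"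
begin

abbreviation "Q \<equiv> path_idem E g"
abbreviation "P \<equiv> cylinder_idem E g"
abbreviation "T \<equiv> edge_sum E g"
abbreviation "T' \<equiv> ghost_sum E g"
abbreviation "X \<equiv> edge_shift E"

section \<open>Vertices and path idempotents\<close>

lemma vertex_edge':
  assumes "v \<in> verts E" "e \<in> arcs E"
  shows "g (Vertex v) * g (Edge e) = (if v = tail E e then g (Edge e) else 0)"
proof -
  have "g (Vertex v) * g (Edge e) = (g (Vertex v) * g (Vertex (tail E e))) * g (Edge e)"
    using vertex_edge[OF assms(2)] by (simp add: mult.assoc)
  then show ?thesis using assms vertex_edge by (auto simp: vertex_vertex)
qed

lemma ghost_vertex':
  assumes "v \<in> verts E" "e \<in> arcs E"
  shows "g (Ghost e) * g (Vertex v) = (if v = tail E e then g (Ghost e) else 0)"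
proof -
  have "g (Ghost e) * g (Vertex v) = g (Ghost e) * (g (Vertex (tail E e)) * g (Vertex v))"
    using ghost_vertex[OF assms(2)] by (simp flip: mult.assoc)
  then show ?thesis using assms ghost_vertex by (auto simp: vertex_vertex)
qed

lemma edge_vertex':
  assumes "v \<in> verts E" "e \<in> arcs E"
  shows "g (Edge e) * g (Vertex v) = (if v = head E e then g (Edge e) else 0)"
proof -
  have "g (Edge e) * g (Vertex v) = g (Edge e) * (g (Vertex (head E e)) * g (Vertex v))"
    using edge_vertex[OF assms(2)] by (simp flip: mult.assoc)
  then show ?thesis using assms edge_vertex by (auto simp: vertex_vertex)
qed

lemma vertex_path_idem_Nil: "v \<in> verts E \<Longrightarrow> g (Vertex v) * Q [] = g (Vertex v)"
  by (simp add: sum_distrib_left vertex_vertex)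

lemma path_idem_Nil_vertex: "v \<in> verts E \<Longrightarrow> Q [] * g (Vertex v) = g (Vertex v)"
  by (simp add: sum_distrib_right vertex_vertex if_distrib cong: if_cong)

lemma edge_path_idem_Nil: "e \<in> arcs E \<Longrightarrow> g (Edge e) * Q [] = g (Edge e)"
  by (simp add: sum_distrib_left edge_vertex')

lemma vertex_path_idem_Cons:
  assumes "v \<in> verts E" "e \<in> arcs E"
  shows "g (Vertex v) * Q (e # w) = (if v = tail E e then Q (e # w) else 0)"
  by (simp add: vertex_edge' assms flip: mult.assoc)

lemma path_idem_Cons_vertex:
  assumes "v \<in> verts E" "e \<in> arcs E"
  shows "Q (e # w) * g (Vertex v) = (if v = tail E e then Q (e # w) else 0)"
  by (simp add: ghost_vertex' assms mult.assoc)

text \<open>For nonempty \<open>w\<close> both products are \<open>Q w\<close> or 0, according to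
  whether \<open>w\<close> starts at \<open>v\<close>; for the empty word both are the vertex
  itself.\<close>

lemma vertex_path_idem_commute:
  assumes "v \<in> verts E" "set w \<subseteq> arcs E"
  shows "g (Vertex v) * Q w = Q w * g (Vertex v)"
  using assms
  by (cases w) (simp_all del: path_idem.simps add: vertex_path_idem_Nil path_idem_Nil_vertex
      vertex_path_idem_Cons path_idem_Cons_vertex)

lemma vertex_path_idem_prefix:
  assumes "x \<in> X" "v = tail E (x 0)"
  shows "g (Vertex v) * Q (edge_prefix (Suc n) x) = Q (edge_prefix (Suc n) x)"
  using assms edge_shift_first[OF assms(1)]
  by (simp del: path_idem.simps add: edge_prefix_Suc_shift vertex_path_idem_Cons)

text \<open>The inner ghost and edge cancel to a vertex or to 0; the vertex moves past
  \<open>Q u\<close> and is absorbed by the outer edge. Equal length excludes proper prefixes, for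
  which the product need not vanish.\<close>

lemma path_idem_mult:
  assumes "length u = length w" "set u \<subseteq> arcs E" "set w \<subseteq> arcs E"
  shows "Q u * Q w = (if u = w then Q u else 0)"
  using assms
proof (induction u w rule: list_induct2)
  case Nil
  have "Q [] * Q [] = (\<Sum>v\<in>verts E. g (Vertex v) * Q [])"
    by (simp add: sum_distrib_right)
  then show ?case by (simp del: path_idem.simps add: vertex_path_idem_Nil) simp
next
  case (Cons e u f w)
  have arcs: "e \<in> arcs E" "f \<in> arcs E" "set u \<subseteq> arcs E" "set w \<subseteq> arcs E"
    using Cons.prems by auto
  have "Q (e # u) * Q (f # w) = g (Edge e) * Q u * (g (Ghost e) * g (Edge f)) * Q w * g (Ghost f)"
    by (simp add: mult.assoc)
  also have "\<dots> = (if e = f then g (Edge e) * (Q u * g (Vertex (head E e))) * Q w * g (Ghost f) else 0)"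
    using arcs by (simp add: ghost_edge mult.assoc)
  also have "\<dots> = (if e = f then (g (Edge e) * g (Vertex (head E e))) * (Q u * Q w) * g (Ghost f) else 0)"
    using arcs by (simp add: mult.assoc flip: vertex_path_idem_commute)
  also have "\<dots> = (if e # u = f # w then Q (e # u) else 0)"
    using arcs Cons.IH by (cases "u = w") (auto simp: edge_vertex)
  finally show ?case .
qed

text \<open>Without sinks every path prolongs to a point of \<open>X\<close>. So a nonempty word
  that is not a prefix has consecutive edges that do not compose, and two orthogonal vertices meet
  there.\<close>

lemma path_idem_not_path:
  assumes "set w \<subseteq> arcs E" "w \<notin> edge_prefix (length w) ` X"
  shows "Q w = 0"
  using assms
proof (induction w)
  case Nil
  \<comment> \<open>The empty word is a prefix of every point, so here there are no points, which
    without sinks happens only for the empty graph.\<close>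
  then have "X = {}" by auto
  then have "verts E = {}" by (metis edge_shift_from_vertex no_sinks empty_iff equals0I)
  then show ?case by simp
next
  case (Cons e w)
  have e: "e \<in> arcs E" using Cons.prems by simp
  show ?case
  proof (cases "w \<in> edge_prefix (length w) ` X")
    case False
    then show ?thesis using Cons by simp
  next
    case True
    then obtain x where x: "x \<in> X" "edge_prefix (length w) x = w" by (metis imageE)
    \<comment> \<open>Otherwise \<open>case_nat e y\<close> would be a point with prefix
      \<open>e # w\<close>.\<close>
    have no_extension: False if "y \<in> X" "edge_prefix (length w) y = w" "head E e = tail E (y 0)" for y
    proof -
      have "e # w = edge_prefix (length (e # w)) (case_nat e y)"
        using that(2) by (simp add: edge_prefix_Suc_shift[of "length w"])
      then show False using that(1,3) e Cons.prems(2) case_nat_in_edge_shift by (metis imageI)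
    qed
    show ?thesis
    proof (cases w)
      case Nil
      \<comment> \<open>A single edge always continues to a point, so this case is
        impossible.\<close>
      obtain y where "y \<in> X" "tail E (y 0) = head E e"
        using edge_shift_from_vertex[OF no_sinks] e head_in_verts by metis
      then have False using no_extension[of y] Nil by simp
      then show ?thesis ..
    next
      case (Cons f u)
      have f: "f = x 0" "f \<in> arcs E"
        using x(2) Cons edge_shift_first(1)[OF x(1)] by (simp_all add: edge_prefix_Suc_shift)
      have "head E e \<noteq> tail E f" using no_extension[of x] x f(1) by metis
      then have "g (Vertex (head E e)) * Q w = 0"
        using Cons f e by (simp del: path_idem.simps add: vertex_path_idem_Cons)
      moreover have "Q (e # w) = g (Edge e) * (g (Vertex (head E e)) * Q w) * g (Ghost e)"
        using e by (simp add: edge_vertex flip: mult.assoc)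
      ultimately show ?thesis by simp
    qed
  qed
qed

text \<open>Summing \<open>vertex_sum\<close> over all vertices rewrites \<open>Q []\<close> as the
  sum of all edges times their ghosts. Multiplying by the edges of \<open>w\<close> on the left and
  their ghosts on the right gives the general case.\<close>

lemma path_idem_append:
  assumes "set w \<subseteq> arcs E"
  shows "Q w = (\<Sum>e\<in>arcs E. Q (w @ [e]))"
  using assms
proof (induction w)
  case Nil
  have "(\<Sum>e\<in>arcs E. Q ([] @ [e])) = (\<Sum>e\<in>arcs E. g (Edge e) * g (Ghost e))"
    by (intro sum.cong refl) (simp add: edge_path_idem_Nil[simplified])
  also have "\<dots> = (\<Sum>e\<in>(\<Union>v\<in>verts E. out_arcs E v). g (Edge e) * g (Ghost e))"
    by (rule sum.cong) (auto simp: out_arcs_def)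
  also have "\<dots> = (\<Sum>v\<in>verts E. \<Sum>e\<in>out_arcs E v. g (Edge e) * g (Ghost e))"
    by (rule sum.UNION_disjoint) (auto simp: out_arcs_def)
  also have "\<dots> = Q []" by (simp add: vertex_sum)
  finally show ?case by simp
next
  case (Cons f w)
  then show ?case by (simp add: sum_distrib_left sum_distrib_right)
qed

lemma finite_edge_prefix_image: "U \<subseteq> X \<Longrightarrow> finite (edge_prefix n ` U)"
  by (rule finite_subset[OF _ finite_lists_length_eq[OF finite_arcs, of n]])
    (auto dest!: subsetD[of U] set_edge_prefix)

text \<open>Appending or prepending arbitrary edges yields words that need not be paths. This
  removes them from a sum, as their idempotents vanish.\<close>

lemma sum_path_idem_prefix:
  assumes "finite M" "edge_prefix n ` U \<subseteq> M" "\<And>w. w \<in> M \<Longrightarrow> length w = n \<and> set w \<subseteq> arcs E"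
    and "\<And>x. x \<in> X \<Longrightarrow> edge_prefix n x \<in> M \<Longrightarrow> edge_prefix n x \<in> edge_prefix n ` U"
  shows "sum Q M = sum Q (edge_prefix n ` U)"
proof (rule sum.mono_neutral_right)
  show "\<forall>w\<in>M - edge_prefix n ` U. Q w = 0"
  proof
    fix w assume w: "w \<in> M - edge_prefix n ` U"
    then have "length w = n" "set w \<subseteq> arcs E" using assms(3) by simp_all
    moreover have "w \<notin> edge_prefix n ` X" using w assms(4) by fast
    ultimately show "Q w = 0" by (simp add: path_idem_not_path)
  qed
  show "finite M" by (fact assms(1))
  show "edge_prefix n ` U \<subseteq> M" by (fact assms(2))
qed

text \<open>Each prefix splits into its one-edge extensions. A point having such an extension as
  prefix lies in \<open>U\<close>, since the shorter prefix already decides membership.\<close>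

lemma sum_path_idem_Suc:
  assumes U: "determined E n U"
  shows "sum Q (edge_prefix n ` U) = sum Q (edge_prefix (Suc n) ` U)"
proof -
  let ?A = "edge_prefix n ` U"
  have UX: "U \<subseteq> X" using U by (rule determined_subset)
  have arcs: "set w \<subseteq> arcs E" if "w \<in> ?A" for w using that UX set_edge_prefix by blast
  then have arcs': "e \<in> arcs E" if "e \<in> set (edge_prefix n x)" "x \<in> U" for e x using that by blast
  have "sum Q ?A = (\<Sum>w\<in>?A. \<Sum>e\<in>arcs E. Q (w @ [e]))"
    by (intro sum.cong refl path_idem_append arcs)
  also have "\<dots> = (\<Sum>(w, e)\<in>?A \<times> arcs E. Q (w @ [e]))"
    by (simp add: sum.cartesian_product)
  also have "\<dots> = sum Q ((\<lambda>(w, e). w @ [e]) ` (?A \<times> arcs E))"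
    by (subst sum.reindex) (auto simp: inj_on_def case_prod_unfold)
  also have "\<dots> = sum Q (edge_prefix (Suc n) ` U)"
  proof (rule sum_path_idem_prefix)
    show "finite ((\<lambda>(w, e). w @ [e]) ` (?A \<times> arcs E))"
      using finite_edge_prefix_image[OF UX] by simp
    have "(edge_prefix n x, x n) \<in> ?A \<times> arcs E" if "x \<in> U" for x
      using that UX by (auto simp: edge_shift_def)
    then show "edge_prefix (Suc n) ` U \<subseteq> (\<lambda>(w, e). w @ [e]) ` (?A \<times> arcs E)"
      by (force simp: edge_prefix_Suc)
  next
    fix x assume "x \<in> X" "edge_prefix (Suc n) x \<in> (\<lambda>(w, e). w @ [e]) ` (?A \<times> arcs E)"
    then have "x \<in> U" using determinedD[OF U, of _ x] by (auto simp: edge_prefix_Suc)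
    then show "edge_prefix (Suc n) x \<in> edge_prefix (Suc n) ` U" by blast
  qed (use arcs' in auto)
  finally show ?thesis .
qed

lemma cylinder_idem_eq:
  assumes "determined E n U"
  shows "P U = sum Q (edge_prefix n ` U)"
proof -
  define m where "m = (LEAST n. determined E n U)"
  have "determined E m U" "m \<le> n"
    unfolding m_def using assms by (auto intro: LeastI Least_le)
  from this(2) have "sum Q (edge_prefix m ` U) = sum Q (edge_prefix n ` U)"
  proof (induction n rule: dec_induct)
    case (step k)
    have "determined E k U" using determined_mono \<open>determined E m U\<close> step.hyps(1) by blast
    then show ?case using sum_path_idem_Suc step.IH by metis
  qed simp
  then show ?thesis by (simp add: cylinder_idem_def m_def)
qed

section \<open>Idempotents of cylindrical sets and their relations with the sums of edges and
  ghosts\<close>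

lemma cylinder_idem_empty: "P {} = 0"
  by (simp add: cylinder_idem_def)

lemma cylinder_idem_Int:
  assumes "cylindrical E U" "cylindrical E V"
  shows "P U * P V = P (U \<inter> V)"
proof -
  obtain n where n: "determined E n U" "determined E n V"
    using assms by (rule cylindrical_common_level)
  let ?A = "edge_prefix n ` U" and ?B = "edge_prefix n ` V"
  have UV: "U \<subseteq> X" "V \<subseteq> X" using n by (auto dest: determined_subset)
  have fin: "finite ?A" "finite ?B" using UV finite_edge_prefix_image by auto
  have "P U * P V = (\<Sum>u\<in>?A. \<Sum>w\<in>?B. Q u * Q w)"
    by (simp add: cylinder_idem_eq[OF n(1)] cylinder_idem_eq[OF n(2)] sum_product)
  also have "\<dots> = (\<Sum>u\<in>?A. \<Sum>w\<in>?B. if u = w then Q u else 0)"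
    by (intro sum.cong refl path_idem_mult) (use UV set_edge_prefix in fastforce)+
  also have "\<dots> = (\<Sum>u\<in>?A. if u \<in> ?B then Q u else 0)"
    using fin by (intro sum.cong) auto
  also have "\<dots> = sum Q (?A \<inter> ?B)"
    using fin by (simp add: sum.inter_restrict)
  \<comment> \<open>A prefix shared by a point of \<open>U\<close> and a point of \<open>V\<close>
    puts both points into both sets, because both sets are determined at level
    \<open>n\<close>.\<close>
  also have "?A \<inter> ?B = edge_prefix n ` (U \<inter> V)"
    using n UV by (auto 4 4 dest: determinedD)
  also have "sum Q \<dots> = P (U \<inter> V)"
    using n by (intro cylinder_idem_eq[symmetric] determined_Int)
  finally show ?thesis .
qed

lemma cylinder_idem_Un:
  assumes "cylindrical E U" "cylindrical E V" "U \<inter> V = {}"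
  shows "P (U \<union> V) = P U + P V"
proof -
  obtain n where n: "determined E n U" "determined E n V"
    using assms(1,2) by (rule cylindrical_common_level)
  have UV: "U \<subseteq> X" "V \<subseteq> X" using n by (auto dest: determined_subset)
  have "edge_prefix n ` U \<inter> edge_prefix n ` V = {}"
    using n UV assms(3) by (auto 4 4 dest: determinedD)
  moreover have "determined E n (U \<union> V)"
    using n by (rule determined_Un)
  ultimately show ?thesis
    using UV by (simp add: cylinder_idem_eq[of n] n image_Un sum.union_disjoint finite_edge_prefix_image)
qed

text \<open>The ghost of \<open>e\<close> kills every summand of \<open>T\<close> except
  \<open>e\<close>, so \<open>T\<close> erases the last ghost of \<open>Q (e # w)\<close>. The
  vertex left over moves past \<open>Q w\<close> and is absorbed by \<open>e\<close>.\<close>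

lemma edge_path_idem_ghost_edge_sum:
  assumes "e \<in> arcs E" "set w \<subseteq> arcs E"
  shows "Q (e # w) * T = g (Edge e) * Q w"
proof -
  have "g (Ghost e) * T = g (Vertex (head E e))"
    using assms by (simp add: edge_sum_def sum_distrib_left ghost_edge)
  then have "Q (e # w) * T = g (Edge e) * (Q w * g (Vertex (head E e)))"
    by (simp add: mult.assoc)
  also have "\<dots> = g (Edge e) * g (Vertex (head E e)) * Q w"
    using assms by (simp add: mult.assoc vertex_path_idem_commute)
  finally show ?thesis using assms by (simp add: edge_vertex)
qed

lemma ghost_sum_path_idem_Cons:
  assumes "e \<in> arcs E" "set w \<subseteq> arcs E"
  shows "T' * Q (e # w) = Q w * g (Ghost e)"
proof -
  have "T' * g (Edge e) = g (Vertex (head E e))"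
    using assms by (simp add: ghost_sum_def sum_distrib_right ghost_edge if_distrib cong: if_cong)
  then have "T' * Q (e # w) = g (Vertex (head E e)) * Q w * g (Ghost e)"
    by (simp flip: mult.assoc)
  also have "\<dots> = Q w * (g (Vertex (head E e)) * g (Ghost e))"
    using assms by (simp add: mult.assoc vertex_path_idem_commute)
  finally show ?thesis using assms by (simp add: vertex_ghost)
qed

text \<open>A point of the preimage is an edge followed by a point of \<open>U\<close>. Words
  \<open>e # w\<close> that do not compose contribute 0, so the sum may range over all
  edges.\<close>

lemma cylinder_idem_shift_preimage:
  assumes U: "determined E n U"
  shows "P (shift_preimage E U) = (\<Sum>e\<in>arcs E. \<Sum>w\<in>edge_prefix n ` U. Q (e # w))"
proof -
  let ?A = "edge_prefix n ` U" and ?V = "shift_preimage E U"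
  have UX: "U \<subseteq> X" using U by (rule determined_subset)
  have arcs: "set w \<subseteq> arcs E" if "w \<in> ?A" for w using that UX set_edge_prefix by blast
  then have arcs': "e \<in> arcs E" if "e \<in> set (edge_prefix n x)" "x \<in> U" for e x using that by blast
  have "(\<Sum>e\<in>arcs E. \<Sum>w\<in>?A. Q (e # w)) = (\<Sum>(e, w)\<in>arcs E \<times> ?A. Q (e # w))"
    by (simp add: sum.cartesian_product)
  also have "\<dots> = sum Q ((\<lambda>(e, w). e # w) ` (arcs E \<times> ?A))"
    by (subst sum.reindex) (auto simp: inj_on_def case_prod_unfold)
  also have "\<dots> = sum Q (edge_prefix (Suc n) ` ?V)"
  proof (rule sum_path_idem_prefix)
    show "finite ((\<lambda>(e, w). e # w) ` (arcs E \<times> ?A))"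
      using finite_edge_prefix_image[OF UX] by simp
    have "(x 0, edge_prefix n (shift_map x)) \<in> arcs E \<times> ?A" if "x \<in> ?V" for x
      using that by (auto simp: shift_preimage_def edge_shift_def)
    then show "edge_prefix (Suc n) ` ?V \<subseteq> (\<lambda>(e, w). e # w) ` (arcs E \<times> ?A)"
      unfolding edge_prefix_Suc_shift by fast
  next
    fix x assume "x \<in> X" "edge_prefix (Suc n) x \<in> (\<lambda>(e, w). e # w) ` (arcs E \<times> ?A)"
    then obtain y where "y \<in> U" "edge_prefix n y = edge_prefix n (shift_map x)"
      by (auto simp: edge_prefix_Suc_shift)
    then have "shift_map x \<in> U"
      using determinedD[OF U] edge_shift_shift_map[OF \<open>x \<in> X\<close>] by blast
    then have "x \<in> ?V" using \<open>x \<in> X\<close> by (simp add: shift_preimage_def)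
    then show "edge_prefix (Suc n) x \<in> edge_prefix (Suc n) ` ?V" by blast
  qed (use arcs' in auto)
  also have "\<dots> = P ?V"
    by (rule cylinder_idem_eq[symmetric, OF determined_shift_preimage[OF U]])
  finally show ?thesis by simp
qed

text \<open>Both sides expand to the sum of \<open>g (Edge e) * Q w\<close> over all edges
  \<open>e\<close> and all prefixes \<open>w\<close> of \<open>U\<close>.\<close>

lemma edge_sum_cylinder_idem:
  assumes "cylindrical E U"
  shows "T * P U = P (shift_preimage E U) * T"
proof -
  obtain n where U: "determined E n U" using assms by (auto simp: cylindrical_def)
  have arcs: "set w \<subseteq> arcs E" if "w \<in> edge_prefix n ` U" for w
    using that determined_subset[OF U] set_edge_prefix by blast
  have "T * P U = (\<Sum>e\<in>arcs E. \<Sum>w\<in>edge_prefix n ` U. g (Edge e) * Q w)"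
    unfolding cylinder_idem_eq[OF U] edge_sum_def sum_product ..
  also have "\<dots> = (\<Sum>e\<in>arcs E. \<Sum>w\<in>edge_prefix n ` U. Q (e # w) * T)"
    by (intro sum.cong refl edge_path_idem_ghost_edge_sum[symmetric] arcs)
  also have "\<dots> = P (shift_preimage E U) * T"
    unfolding cylinder_idem_shift_preimage[OF U] by (simp only: sum_distrib_right)
  finally show ?thesis .
qed

lemma cylinder_idem_ghost_sum:
  assumes "cylindrical E U"
  shows "P U * T' = T' * P (shift_preimage E U)"
proof -
  obtain n where U: "determined E n U" using assms by (auto simp: cylindrical_def)
  have arcs: "set w \<subseteq> arcs E" if "w \<in> edge_prefix n ` U" for w
    using that determined_subset[OF U] set_edge_prefix by blast
  have "P U * T' = (\<Sum>e\<in>arcs E. \<Sum>w\<in>edge_prefix n ` U. Q w * g (Ghost e))"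
    unfolding cylinder_idem_eq[OF U] ghost_sum_def sum_product by (rule sum.swap)
  also have "\<dots> = (\<Sum>e\<in>arcs E. \<Sum>w\<in>edge_prefix n ` U. T' * Q (e # w))"
    by (intro sum.cong refl ghost_sum_path_idem_Cons[symmetric] arcs)
  also have "\<dots> = T' * P (shift_preimage E U)"
    unfolding cylinder_idem_shift_preimage[OF U] by (simp only: sum_distrib_left)
  finally show ?thesis .
qed

text \<open>If two prefixes agree after the first edge, put the first edge of \<open>y\<close>
  before \<open>shift_map x\<close>. The result lies in \<open>U\<close>, as it has the prefix of
  \<open>y\<close>, and has the same shift as \<open>x\<close>, so injectivity makes it equal to
  \<open>x\<close>. Length at least 2 ensures that the exchanged edge fits.\<close>

lemma inj_on_tl_edge_prefix:
  assumes U: "determined E (Suc (Suc n)) U" and inj: "inj_on shift_map U"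
  shows "inj_on tl (edge_prefix (Suc (Suc n)) ` U)"
proof (rule inj_onI)
  fix u w assume "u \<in> edge_prefix (Suc (Suc n)) ` U" "w \<in> edge_prefix (Suc (Suc n)) ` U" "tl u = tl w"
  then obtain x y where xy: "x \<in> U" "y \<in> U"
    and u: "u = edge_prefix (Suc (Suc n)) x" and w: "w = edge_prefix (Suc (Suc n)) y"
    and eq: "edge_prefix (Suc n) (shift_map x) = edge_prefix (Suc n) (shift_map y)"
    by (auto simp: edge_prefix_Suc_shift[of "Suc n"])
  have X: "x \<in> X" "y \<in> X" using xy U by (auto dest: determined_subset)
  let ?z = "case_nat (y 0) (shift_map x)"
  have "shift_map x 0 = shift_map y 0" using eq by (simp add: edge_prefix_Suc_shift)
  then have "?z \<in> X"
    using X by (intro case_nat_in_edge_shift) (auto dest: edge_shift_first edge_shift_shift_map)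
  moreover have z: "edge_prefix (Suc (Suc n)) y = edge_prefix (Suc (Suc n)) ?z"
    using eq by (simp add: edge_prefix_Suc_shift[of "Suc n"])
  ultimately have "?z \<in> U" using determinedD[OF U xy(2)] by blast
  then have "?z = x" using inj_onD[OF inj _ _ xy(1)] by simp
  then show "u = w" using u w z by simp
qed

text \<open>Sandwiching between \<open>T'\<close> and \<open>T\<close> deletes the first edge of
  every path. Injectivity of the shift keeps the shortened words distinct, so no idempotent is
  counted twice.\<close>

lemma ghost_sum_cylinder_idem_edge_sum:
  assumes "cylindrical E U" "inj_on shift_map U"
  shows "T' * P U * T = P (shift_map ` U)"
proof -
  \<comment> \<open>Raising the level to at least 2 leaves a nonempty word when the first edge is
    deleted.\<close>
  obtain n where U: "determined E (Suc (Suc n)) U"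
    using assms(1) unfolding cylindrical_def by (meson determined_mono le_SucI order_refl)
  let ?A = "edge_prefix (Suc (Suc n)) ` U"
  have "T' * P U * T = (\<Sum>w\<in>?A. T' * Q w * T)"
    unfolding cylinder_idem_eq[OF U] by (simp add: sum_distrib_left sum_distrib_right)
  also have "\<dots> = (\<Sum>w\<in>?A. Q (tl w))"
  proof (rule sum.cong[OF refl])
    fix w assume "w \<in> ?A"
    then obtain x where x: "x \<in> X" "w = x 0 # edge_prefix (Suc n) (shift_map x)"
      using determined_subset[OF U] by (auto simp: edge_prefix_Suc_shift[of "Suc n"])
    define u where "u = edge_prefix (Suc n) (shift_map x)"
    have arcs: "x 0 \<in> arcs E" "set u \<subseteq> arcs E"
      using x edge_shift_first set_edge_prefix edge_shift_shift_map unfolding u_def by blast+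
    have "T' * Q w * T = T' * (g (Edge (x 0)) * Q u)"
      using x arcs by (simp del: path_idem.simps add: mult.assoc edge_path_idem_ghost_edge_sum flip: u_def)
    also have "\<dots> = g (Vertex (head E (x 0))) * Q u"
      using arcs by (simp add: ghost_sum_def sum_distrib_right ghost_edge if_distrib
          flip: mult.assoc cong: if_cong)
    also have "\<dots> = Q u"
      unfolding u_def using x edge_shift_shift_map edge_shift_first
      by (intro vertex_path_idem_prefix) auto
    finally show "T' * Q w * T = Q (tl w)" using x u_def by simp
  qed
  also have "\<dots> = sum Q (tl ` ?A)"
    by (subst sum.reindex[OF inj_on_tl_edge_prefix[OF U assms(2)]]) simp
  also have "tl ` ?A = edge_prefix (Suc n) ` shift_map ` U"
    by (simp add: image_image edge_prefix_Suc_shift[of "Suc n"])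
  also have "sum Q \<dots> = P (shift_map ` U)"
    by (rule cylinder_idem_eq[symmetric, OF determined_shift_image[OF U]])
  finally show ?thesis .
qed

text \<open>In \<open>Q u * T * (T' * Q w)\<close> the path idempotents of the two tails meet. The
  product vanishes unless the tails agree, and then \<open>u = w\<close> by
  \<open>inj_on_tl_edge_prefix\<close>.\<close>

lemma cylinder_idem_edge_sum_ghost_sum:
  assumes "cylindrical E U" "inj_on shift_map U"
  shows "P U * T * T' * P U = P U"
proof -
  obtain n where U: "determined E (Suc (Suc n)) U"
    using assms(1) unfolding cylindrical_def by (meson determined_mono le_SucI order_refl)
  let ?A = "edge_prefix (Suc (Suc n)) ` U"
  have fin: "finite ?A" using finite_edge_prefix_image determined_subset[OF U] by blast
  have key: "Q u * T * (T' * Q w) = (if u = w then Q u else 0)" if u: "u \<in> ?A" and w: "w \<in> ?A" for u w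
  proof -
    have "\<exists>e u'. u = e # u' \<and> length u' = Suc n \<and> e \<in> arcs E \<and> set u' \<subseteq> arcs E" if uA: "u \<in> ?A" for u
    proof -
      obtain x where "x \<in> X" "u = edge_prefix (Suc (Suc n)) x"
        using uA determined_subset[OF U] by blast
      then show ?thesis using edge_shift_first(1) set_edge_prefix edge_shift_shift_map
        unfolding edge_prefix_Suc_shift[of "Suc n"] by (metis length_edge_prefix)
    qed
    from this[OF u] this[OF w] obtain e u' f w' where
      eq: "u = e # u'" "w = f # w'" and len: "length u' = length w'"
      and arcs: "e \<in> arcs E" "set u' \<subseteq> arcs E" "f \<in> arcs E" "set w' \<subseteq> arcs E"
      by metis
    have "Q u * T * (T' * Q w) = g (Edge e) * Q u' * (Q w' * g (Ghost f))"
      unfolding eq using arcs by (simp only: edge_path_idem_ghost_edge_sum ghost_sum_path_idem_Cons)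
    also have "\<dots> = g (Edge e) * (Q u' * Q w') * g (Ghost f)"
      by (simp add: mult.assoc)
    also have "\<dots> = (if u' = w' then g (Edge e) * Q u' * g (Ghost f) else 0)"
      using arcs len by (simp add: path_idem_mult)
    finally show ?thesis
      using inj_onD[OF inj_on_tl_edge_prefix[OF U assms(2)] _ u w] eq by auto
  qed
  have "P U * T * T' * P U = (P U * T) * (T' * P U)" by (simp add: mult.assoc)
  also have "\<dots> = (\<Sum>u\<in>?A. \<Sum>w\<in>?A. (Q u * T) * (T' * Q w))"
    unfolding cylinder_idem_eq[OF U] by (simp only: sum_distrib_left[of T'] sum_distrib_right[of _ _ T] sum_product)
  also have "\<dots> = (\<Sum>u\<in>?A. \<Sum>w\<in>?A. if u = w then Q u else 0)"
    by (intro sum.cong refl key)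
  also have "\<dots> = P U"
    using fin by (simp add: cylinder_idem_eq[OF U])
  finally show ?thesis .
qed

lemma cylinder_idem_edge_shift_edge_sum: "P X * T = T"
proof -
  have "determined E 0 X" by (simp add: determined_def)
  moreover have "Q [] * T = T"
    unfolding edge_sum_def path_idem.simps sum_product
    by (subst sum.swap) (auto intro!: sum.cong simp: vertex_edge' if_distrib cong: if_cong)
  \<comment> \<open>Without vertices there are no points, so the sum over prefixes is empty;
    \<open>T\<close> is then 0 as well.\<close>
  moreover have "edge_prefix 0 ` X = {[]}" if "verts E \<noteq> {}"
    using that edge_shift_from_vertex[OF no_sinks] by (auto simp: image_iff)
  moreover have "T = 0" if "verts E = {}"
    using that tail_in_verts by (auto simp: edge_sum_def intro!: sum.neutral)
  ultimately show ?thesis by (cases "verts E = {}") (auto simp: cylinder_idem_eq[of 0])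
qed

lemma ghost_sum_cylinder_idem_edge_shift: "T' * P X = T'"
proof -
  have "determined E 0 X" by (simp add: determined_def)
  moreover have "T' * Q [] = T'"
    unfolding ghost_sum_def path_idem.simps sum_product
    by (auto intro!: sum.cong simp: ghost_vertex' if_distrib cong: if_cong)
  moreover have "edge_prefix 0 ` X = {[]}" if "verts E \<noteq> {}"
    using that edge_shift_from_vertex[OF no_sinks] by (auto simp: image_iff)
  moreover have "T' = 0" if "verts E = {}"
    using that tail_in_verts by (auto simp: ghost_sum_def intro!: sum.neutral)
  ultimately show ?thesis by (cases "verts E = {}") (auto simp: cylinder_idem_eq[of 0])
qed

end

section \<open>Representations of the shift\<close>

text \<open>
  The purely dynamical relations between the idempotents \<open>R U = 1\<^sub>U\<close> of cylindrical sets and the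
  sums \<open>T\<close>, \<open>T'\<close> of all edges and of all ghosts.  They mention the shift space only, so a conjugacy
  carries them over.
\<close>

locale shift_representation = fin_digraph E
  for E :: "('v, 'e) pre_digraph" and R :: "(nat \<Rightarrow> 'e) set \<Rightarrow> 'a::ring" and T T' :: 'a +
  assumes no_sinks: "no_sinks E"
    and empty: "R {} = 0"
    and mult: "cylindrical E U \<Longrightarrow> cylindrical E V \<Longrightarrow> R U * R V = R (U \<inter> V)"
    and add: "cylindrical E U \<Longrightarrow> cylindrical E V \<Longrightarrow> U \<inter> V = {} \<Longrightarrow> R (U \<union> V) = R U + R V"
    and T_commute: "cylindrical E U \<Longrightarrow> T * R U = R (shift_preimage E U) * T"
    and T'_commute: "cylindrical E U \<Longrightarrow> R U * T' = T' * R (shift_preimage E U)"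
    and T'_T: "cylindrical E U \<Longrightarrow> inj_on shift_map U \<Longrightarrow> T' * R U * T = R (shift_map ` U)"
    and T_T': "cylindrical E U \<Longrightarrow> inj_on shift_map U \<Longrightarrow> R U * T * T' * R U = R U"
    and T_unit: "R (edge_shift E) * T = T"
    and T'_unit: "T' * R (edge_shift E) = T'"

sublocale leavitt_family \<subseteq> shift_representation E P T T'
  by unfold_locales
    (fact no_sinks cylinder_idem_empty cylinder_idem_Int cylinder_idem_Un edge_sum_cylinder_idem
      cylinder_idem_ghost_sum ghost_sum_cylinder_idem_edge_sum cylinder_idem_edge_sum_ghost_sum
      cylinder_idem_edge_shift_edge_sum ghost_sum_cylinder_idem_edge_shift)+

primrec shift_generators ::
  "('v, 'e) pre_digraph \<Rightarrow> ((nat \<Rightarrow> 'e) set \<Rightarrow> 'a::ring) \<Rightarrow> 'a \<Rightarrow> 'a \<Rightarrow> ('v, 'e) leavitt_gen \<Rightarrow> 'a" where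
  "shift_generators E R T T' (Vertex v) = R (vertex_cylinder E v)"
| "shift_generators E R T T' (Edge e) = R (edge_cylinder E e) * T"
| "shift_generators E R T T' (Ghost e) = T' * R (edge_cylinder E e)"

context shift_representation
begin

abbreviation "h \<equiv> shift_generators E R T T'"

lemma UN_disjoint:
  assumes "finite I" "\<And>i. i \<in> I \<Longrightarrow> cylindrical E (U i)" "disjoint_family_on U I"
  shows "R (\<Union>i\<in>I. U i) = (\<Sum>i\<in>I. R (U i))"
  using assms
proof (induction I rule: finite_induct)
  case (insert i I)
  have "U i \<inter> (\<Union>j\<in>I. U j) = {}"
    using insert.prems(2) insert.hyps(2) by (auto simp: disjoint_family_on_def)
  moreover have "disjoint_family_on U I"
    using insert.prems(2) by (auto simp: disjoint_family_on_def)
  ultimately show ?case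
    using insert by (simp add: add cylindrical_UN)
qed (simp add: empty)

lemma disjoint_edge_cylinders: "disjoint_family_on (edge_cylinder E) I"
  by (auto simp: disjoint_family_on_def edge_cylinder_def)

lemma disjoint_vertex_cylinders: "disjoint_family_on (vertex_cylinder E) I"
  by (auto simp: disjoint_family_on_def vertex_cylinder_def)

text \<open>Each relation becomes a fact on cylinders: vertex cylinders are disjoint, and
  partitioned by the cylinders of the outgoing edges; an edge cylinder lies in that of its source,
  and the shift maps it injectively onto that of its range.\<close>

lemma leavitt_family_shift_generators: "leavitt_family E h"
proof unfold_locales
  show "no_sinks E" by (fact no_sinks)
next
  fix v w assume "v \<in> verts E" "w \<in> verts E"
  have "vertex_cylinder E v \<inter> vertex_cylinder E w = (if v = w then vertex_cylinder E v else {})"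
    by (auto simp: vertex_cylinder_def)
  then show "h (Vertex v) * h (Vertex w) = (if v = w then h (Vertex v) else 0)"
    by (simp add: mult empty)
next
  fix e assume e: "e \<in> arcs E"
  have sub: "edge_cylinder E e \<subseteq> vertex_cylinder E (tail E e)"
    by (auto simp: edge_cylinder_def vertex_cylinder_def)
  \<comment> \<open>To meet the idempotent of \<open>edge_cylinder E e\<close>, the range vertex
    must cross \<open>T\<close> or \<open>T'\<close>, which replaces its cylinder by the shift
    preimage.\<close>
  have "edge_cylinder E e \<subseteq> shift_preimage E (vertex_cylinder E (head E e))"
    using shift_edge_cylinder[OF e] by (auto simp: shift_preimage_def edge_cylinder_def)
  then have pre: "edge_cylinder E e \<inter> shift_preimage E (vertex_cylinder E (head E e)) = edge_cylinder E e"
      "shift_preimage E (vertex_cylinder E (head E e)) \<inter> edge_cylinder E e = edge_cylinder E e"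
    by blast+
  show "h (Vertex (tail E e)) * h (Edge e) = h (Edge e)"
    using sub by (simp add: mult Int_absorb1 flip: mult.assoc)
  show "h (Ghost e) * h (Vertex (tail E e)) = h (Ghost e)"
    using sub by (simp add: mult Int_absorb2 mult.assoc)
  show "h (Edge e) * h (Vertex (head E e)) = h (Edge e)"
    by (simp add: mult.assoc T_commute) (simp add: mult pre cylindrical_shift_preimage flip: mult.assoc)
  show "h (Vertex (head E e)) * h (Ghost e) = h (Ghost e)"
    by (simp add: T'_commute flip: mult.assoc) (simp add: mult pre cylindrical_shift_preimage mult.assoc)
next
  fix e f assume e: "e \<in> arcs E"
  have "h (Ghost e) * h (Edge f) = T' * (R (edge_cylinder E e) * R (edge_cylinder E f)) * T"
    by (simp add: mult.assoc)
  also have "\<dots> = T' * R (edge_cylinder E e \<inter> edge_cylinder E f) * T"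
    by (simp add: mult)
  also have "edge_cylinder E e \<inter> edge_cylinder E f = (if e = f then edge_cylinder E e else {})"
    by (auto simp: edge_cylinder_def)
  also have "T' * R \<dots> * T = (if e = f then h (Vertex (head E e)) else 0)"
    using e by (cases "e = f") (simp_all add: empty T'_T inj_on_shift_edge_cylinder shift_edge_cylinder)
  finally show "h (Ghost e) * h (Edge f) = (if e = f then h (Vertex (head E e)) else 0)" .
next
  fix v assume "v \<in> verts E"
  have "h (Vertex v) = (\<Sum>e\<in>out_arcs E v. R (edge_cylinder E e))"
    by (simp add: vertex_cylinder_eq_UN UN_disjoint disjoint_edge_cylinders finite_out_arcs)
  \<comment> \<open>By \<open>T_T'\<close> an edge times its ghost is the idempotent of the edge
    cylinder.\<close>
  also have "\<dots> = (\<Sum>e\<in>out_arcs E v. h (Edge e) * h (Ghost e))"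
    using T_T' by (simp add: inj_on_shift_edge_cylinder flip: mult.assoc)
  finally show "h (Vertex v) = (\<Sum>e\<in>out_arcs E v. h (Edge e) * h (Ghost e))" .
qed

lemma edge_sum_shift_generators: "edge_sum E h = T"
proof -
  have "edge_sum E h = R (edge_shift E) * T"
    by (simp add: edge_sum_def edge_shift_eq_UN UN_disjoint disjoint_edge_cylinders sum_distrib_right)
  then show ?thesis by (simp add: T_unit)
qed

lemma ghost_sum_shift_generators: "ghost_sum E h = T'"
proof -
  have "ghost_sum E h = T' * R (edge_shift E)"
    by (simp add: ghost_sum_def edge_shift_eq_UN UN_disjoint disjoint_edge_cylinders sum_distrib_left)
  then show ?thesis by (simp add: T'_unit)
qed

text \<open>Moving the idempotent of the cylinder of \<open>w\<close> leftwards across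
  \<open>T\<close> turns the cylinder into its shift preimage, which meets
  \<open>edge_cylinder E e\<close> in the cylinder of \<open>e # w\<close>.\<close>

lemma path_idem_shift_generators:
  "path_idem E h w = R {x \<in> edge_shift E. edge_prefix (length w) x = w}"
proof (induction w)
  case Nil
  have X: "edge_shift E = (\<Union>v\<in>verts E. vertex_cylinder E v)"
    by (auto simp: vertex_cylinder_def intro: tail_in_verts edge_shift_first(1))
  have "R (edge_shift E) = (\<Sum>v\<in>verts E. R (vertex_cylinder E v))"
    unfolding X by (rule UN_disjoint) (simp_all add: disjoint_vertex_cylinders)
  then show ?case by simp
next
  case (Cons e w)
  let ?U = "{x \<in> edge_shift E. edge_prefix (length w) x = w}" and ?B = "edge_cylinder E e"
  have "determined E (length w) ?U" by (auto simp: determined_def)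
  then have U: "cylindrical E ?U" by (auto simp: cylindrical_def)
  let ?W = "?B \<inter> shift_preimage E ?U"
  have W: "cylindrical E ?W" using U by (intro cylindrical_Int cylindrical_shift_preimage) simp_all
  have "path_idem E h (e # w) = R ?B * (T * R ?U) * T' * R ?B"
    using Cons.IH by (simp add: mult.assoc)
  also have "\<dots> = (R ?B * R (shift_preimage E ?U)) * T * T' * R ?B"
    using U by (simp add: T_commute mult.assoc)
  \<comment> \<open>\<open>?W\<close> lies in \<open>?B\<close>, so a factor \<open>R ?B\<close> can
    be inserted, which makes \<open>T_T'\<close> applicable.\<close>
  also have "\<dots> = (R ?W * R ?B) * T * T' * R ?B"
    using U W by (simp add: mult cylindrical_shift_preimage Int_absorb2)
  also have "\<dots> = R ?W * (R ?B * T * T' * R ?B)"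
    by (simp add: mult.assoc)
  also have "\<dots> = R ?W"
    using W by (simp add: T_T' inj_on_shift_edge_cylinder mult Int_absorb2)
  also have "?W = {x \<in> edge_shift E. edge_prefix (length (e # w)) x = e # w}"
    by (auto simp: edge_cylinder_def shift_preimage_def edge_prefix_Suc_shift edge_shift_shift_map)
  finally show ?case .
qed

text \<open>\<open>U\<close> is the disjoint union of the cylinders over its prefixes, and
  \<open>R\<close> is additive.\<close>

lemma cylinder_idem_shift_generators:
  assumes "cylindrical E U"
  shows "cylinder_idem E h U = R U"
proof -
  interpret L: leavitt_family E h by (rule leavitt_family_shift_generators)
  obtain n where n: "determined E n U" using assms by (auto simp: cylindrical_def)
  have U: "U \<subseteq> edge_shift E" using n by (rule determined_subset)
  let ?Z = "\<lambda>w. {x \<in> edge_shift E. edge_prefix n x = w}"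
  have "cylinder_idem E h U = (\<Sum>w\<in>edge_prefix n ` U. R (?Z w))"
    unfolding L.cylinder_idem_eq[OF n] by (intro sum.cong) (auto simp: path_idem_shift_generators)
  also have "\<dots> = R (\<Union>w\<in>edge_prefix n ` U. ?Z w)"
  proof (rule UN_disjoint[symmetric])
    show "finite (edge_prefix n ` U)" using U by (rule L.finite_edge_prefix_image)
    have "determined E n (?Z w)" for w by (auto simp: determined_def)
    then show "cylindrical E (?Z w)" for w unfolding cylindrical_def by blast
  qed (auto simp: disjoint_family_on_def)
  also have "(\<Union>w\<in>edge_prefix n ` U. ?Z w) = U"
    using U determinedD[OF n] by fastforce
  finally show ?thesis .
qed

end

text \<open>An edge cylinder has the edge times its ghost as idempotent; \<open>T\<close> on the
  right turns the ghost into the range vertex, and \<open>T'\<close> on the left does so with the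
  edge. Vertices follow from \<open>vertex_sum\<close>.\<close>

lemma (in leavitt_family) shift_generators_eq:
  "v \<in> verts E \<Longrightarrow> shift_generators E P T T' (Vertex v) = g (Vertex v)"
  "e \<in> arcs E \<Longrightarrow> shift_generators E P T T' (Edge e) = g (Edge e)"
  "e \<in> arcs E \<Longrightarrow> shift_generators E P T T' (Ghost e) = g (Ghost e)"
proof -
  have idem: "P (edge_cylinder E e) = g (Edge e) * g (Ghost e)" if e: "e \<in> arcs E" for e
  proof -
    have "determined E (Suc 0) (edge_cylinder E e)"
      unfolding edge_cylinder_def by (rule determined_first)
    then have "P (edge_cylinder E e) = sum Q (edge_prefix (Suc 0) ` edge_cylinder E e)"
      by (rule cylinder_idem_eq)
    \<comment> \<open>The cylinder has a point because there are no sinks; otherwise the set of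
      prefixes would be empty.\<close>
    also have "edge_prefix (Suc 0) ` edge_cylinder E e = {[e]}"
    proof -
      obtain x where "x \<in> X" "tail E (x 0) = head E e"
        using edge_shift_from_vertex[OF no_sinks head_in_verts[OF e]] by blast
      then have "case_nat e x \<in> edge_cylinder E e"
        using e by (simp add: edge_cylinder_def case_nat_in_edge_shift)
      then show ?thesis by (auto simp: edge_cylinder_def edge_prefix_Suc_shift)
    qed
    finally show ?thesis using e by (simp add: edge_path_idem_Nil[simplified])
  qed
  show "shift_generators E P T T' (Edge e) = g (Edge e)" if "e \<in> arcs E"
    using that idem
    by (simp add: mult.assoc edge_sum_def sum_distrib_left ghost_edge if_distrib edge_vertex cong: if_cong)
  show "shift_generators E P T T' (Ghost e) = g (Ghost e)" if "e \<in> arcs E"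
    using that idem
    by (simp add: ghost_sum_def sum_distrib_right ghost_edge if_distrib vertex_ghost
        flip: mult.assoc cong: if_cong)
  show "shift_generators E P T T' (Vertex v) = g (Vertex v)" if "v \<in> verts E"
    using that idem
    by (simp add: vertex_cylinder_eq_UN UN_disjoint disjoint_edge_cylinders finite_out_arcs vertex_sum)
qed

section \<open>Conjugacies\<close>

text \<open>Continuity is replaced by a condition on cylindrical sets, the form in which the algebra
  sees it.\<close>

locale cylindrical_conjugacy = E: fin_digraph E + F: fin_digraph F
  for E :: "('v, 'e) pre_digraph" and F :: "('w, 'f) pre_digraph" +
  fixes \<phi> :: "(nat \<Rightarrow> 'e) \<Rightarrow> (nat \<Rightarrow> 'f)"
  assumes no_sinks_E: "no_sinks E" and no_sinks_F: "no_sinks F"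
    and bij: "bij_betw \<phi> (edge_shift E) (edge_shift F)"
    and commute: "x \<in> edge_shift E \<Longrightarrow> \<phi> (shift_map x) = shift_map (\<phi> x)"
    and cylindrical_image: "cylindrical E U \<Longrightarrow> cylindrical F (\<phi> ` U)"
begin

lemma shift_preimage_image:
  assumes "U \<subseteq> edge_shift E"
  shows "shift_preimage F (\<phi> ` U) = \<phi> ` shift_preimage E U"
proof
  show "\<phi> ` shift_preimage E U \<subseteq> shift_preimage F (\<phi> ` U)"
    using bij by (auto simp: shift_preimage_def bij_betw_def simp flip: commute)
  show "shift_preimage F (\<phi> ` U) \<subseteq> \<phi> ` shift_preimage E U"
  proof
    fix y assume y: "y \<in> shift_preimage F (\<phi> ` U)"
    then obtain x where x: "x \<in> edge_shift E" "y = \<phi> x"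
      using bij unfolding shift_preimage_def bij_betw_def by blast
    obtain u where u: "u \<in> U" "shift_map y = \<phi> u"
      using y by (auto simp: shift_preimage_def)
    with x have "\<phi> (shift_map x) = \<phi> u" by (simp add: commute)
    moreover have "shift_map x \<in> edge_shift E" "u \<in> edge_shift E"
      using x u assms edge_shift_shift_map by blast+
    ultimately have "shift_map x = u"
      using bij_betw_imp_inj_on[OF bij] by (blast dest: inj_onD)
    then show "y \<in> \<phi> ` shift_preimage E U"
      using x u by (auto simp: shift_preimage_def)
  qed
qed

lemma shift_map_image:
  "U \<subseteq> edge_shift E \<Longrightarrow> shift_map ` \<phi> ` U = \<phi> ` shift_map ` U"
  unfolding image_image by (rule image_cong) (auto simp: commute)

lemma inj_on_shift_map_image:
  assumes U: "U \<subseteq> edge_shift E" and inj: "inj_on shift_map U"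
  shows "inj_on shift_map (\<phi> ` U)"
proof (rule inj_onI)
  fix y z assume "y \<in> \<phi> ` U" "z \<in> \<phi> ` U" and eq: "shift_map y = shift_map z"
  then obtain u v where uv: "u \<in> U" "v \<in> U" "y = \<phi> u" "z = \<phi> v" by blast
  then have "\<phi> (shift_map u) = \<phi> (shift_map v)"
    using U eq commute by (metis subsetD)
  moreover have "shift_map u \<in> edge_shift E" "shift_map v \<in> edge_shift E"
    using uv U edge_shift_shift_map by blast+
  ultimately have "shift_map u = shift_map v"
    using bij_betw_imp_inj_on[OF bij] by (blast dest: inj_onD)
  then show "y = z" using inj uv by (auto dest: inj_onD)
qed

text \<open>The axioms speak of Boolean operations, injectivity of the shift, and shift images and
  preimages, all of which an equivariant bijection respects.\<close>

lemma shift_representation_pullback: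
  assumes "shift_representation F R T T'"
  shows "shift_representation E (\<lambda>U. R (\<phi> ` U)) T T'"
proof -
  interpret R: shift_representation F R T T' by (rule assms)
  have Int: "\<phi> ` (U \<inter> V) = \<phi> ` U \<inter> \<phi> ` V" if "cylindrical E U" "cylindrical E V" for U V
    using that bij cylindrical_subset by (metis bij_betw_def inj_on_image_Int)
  note sub = cylindrical_subset[of E]
  show ?thesis
  proof unfold_locales
    show "R (\<phi> ` (U \<union> V)) = R (\<phi> ` U) + R (\<phi> ` V)"
      if "cylindrical E U" "cylindrical E V" "U \<inter> V = {}" for U V
      using that Int[of U V] by (simp add: image_Un R.add cylindrical_image)
  qed (use bij in \<open>simp_all add: no_sinks_E R.empty Int R.mult R.T_commute R.T'_commute R.T'_T R.T_T'
      R.T_unit R.T'_unit sub inj_on_shift_map_image shift_map_image shift_preimage_image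
      cylindrical_image bij_betw_def\<close>)
qed

end

section \<open>Cylindrical sets are the clopen sets\<close>

text \<open>A basic open set restricts finitely many coordinates, all below some \<open>n\<close>.
  Conversely, fixing the first \<open>n\<close> coordinates is an open condition since the factors
  are discrete.\<close>

lemma openin_sequences_iff:
  "openin (product_topology (\<lambda>_. discrete_topology A) UNIV) S \<longleftrightarrow>
     S \<subseteq> (UNIV \<rightarrow> A) \<and>
     (\<forall>x\<in>S. \<exists>n. \<forall>y\<in>UNIV \<rightarrow> A. edge_prefix n x = edge_prefix n y \<longrightarrow> y \<in> S)"
    (is "?open \<longleftrightarrow> ?sub \<and> (\<forall>x\<in>S. ?nbhd x)")
proof (intro iffI conjI ballI)
  assume S: ?open
  show ?sub using openin_subset[OF S] by (auto simp: PiE_UNIV_domain)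
  fix x assume "x \<in> S"
  then obtain U where fin: "finite {i. U i \<noteq> A}" and x: "x \<in> Pi\<^sub>E UNIV U" and US: "Pi\<^sub>E UNIV U \<subseteq> S"
    using S unfolding openin_product_topology_alt by fastforce
  obtain n where n: "\<And>i. U i \<noteq> A \<Longrightarrow> i < n"
    using finite_nat_bounded[OF fin] by auto
  have "y \<in> S" if "y \<in> UNIV \<rightarrow> A" "edge_prefix n x = edge_prefix n y" for y
  proof -
    have "y i \<in> U i" for i
    proof (cases "U i = A")
      case False
      then have "y i = x i" using that(2) n by (simp add: edge_prefix_eq_iff)
      then show ?thesis using x by auto
    qed (use that(1) in auto)
    then show ?thesis using US by auto
  qed
  then show "?nbhd x" by blast
next
  assume S: "?sub \<and> (\<forall>x\<in>S. ?nbhd x)"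
  show ?open
    unfolding openin_product_topology_alt
  proof
    fix x assume x: "x \<in> S"
    then obtain n where n: "\<And>y. y \<in> UNIV \<rightarrow> A \<Longrightarrow> edge_prefix n x = edge_prefix n y \<Longrightarrow> y \<in> S"
      using S by blast
    define U where "U i = (if i < n then {x i} else A)" for i
    have xA: "x i \<in> A" for i using x S by auto
    have "finite {i \<in> UNIV. U i \<noteq> topspace (discrete_topology A)}"
      by (rule finite_subset[of _ "{..<n}"]) (auto simp: U_def)
    moreover have "\<forall>i\<in>UNIV. openin (discrete_topology A) (U i)"
      using xA by (simp add: U_def)
    moreover have "x \<in> Pi\<^sub>E UNIV U" using xA by (auto simp: U_def)
    moreover have "Pi\<^sub>E UNIV U \<subseteq> S"
    proof
      fix y assume "y \<in> Pi\<^sub>E UNIV U"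
      then have y: "y i \<in> U i" for i by auto
      have "y i \<in> A" for i using y[of i] xA[of i] by (auto simp: U_def split: if_splits)
      moreover have "edge_prefix n x = edge_prefix n y"
        unfolding edge_prefix_eq_iff
      proof (intro allI impI)
        fix i assume "i < n"
        then show "x i = y i" using y[of i] by (simp add: U_def)
      qed
      ultimately show "y \<in> S" using n by auto
    qed
    ultimately show "\<exists>U. finite {i \<in> UNIV. U i \<noteq> topspace (discrete_topology A)} \<and>
        (\<forall>i\<in>UNIV. openin (discrete_topology A) (U i)) \<and> x \<in> Pi\<^sub>E UNIV U \<and> Pi\<^sub>E UNIV U \<subseteq> S"
      by blast
  qed
qed

section \<open>Compactness and clopen sets of the edge shift\<close>

lemma edge_shift_subset_sequences: "edge_shift E \<subseteq> (UNIV \<rightarrow> arcs E)"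
  by (auto simp: edge_shift_def)

lemma topspace_edge_shift_topology: "topspace (edge_shift_topology E) = edge_shift E"
  using edge_shift_subset_sequences by (auto simp: edge_shift_topology_def PiE_UNIV_domain)

text \<open>A mismatch between two consecutive edges shows in a finite prefix, so the complement is
  open.\<close>

lemma closedin_edge_shift:
  "closedin (product_topology (\<lambda>_. discrete_topology (arcs E)) UNIV) (edge_shift E)"
proof -
  have "openin (product_topology (\<lambda>_. discrete_topology (arcs E)) UNIV) ((UNIV \<rightarrow> arcs E) - edge_shift E)"
    unfolding openin_sequences_iff
  proof (intro conjI ballI)
    fix x assume "x \<in> (UNIV \<rightarrow> arcs E) - edge_shift E"
    then obtain i where i: "head E (x i) \<noteq> tail E (x (Suc i))"
      by (auto simp: edge_shift_def)
    have "y \<notin> edge_shift E" if "edge_prefix (Suc (Suc i)) x = edge_prefix (Suc (Suc i)) y" for y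
      using that i by (auto simp: edge_prefix_eq_iff edge_shift_def)
    then show "\<exists>n. \<forall>y\<in>UNIV \<rightarrow> arcs E. edge_prefix n x = edge_prefix n y \<longrightarrow>
        y \<in> (UNIV \<rightarrow> arcs E) - edge_shift E" by blast
  qed blast
  then show ?thesis
    using edge_shift_subset_sequences by (simp add: closedin_def PiE_UNIV_domain)
qed

lemma compact_space_edge_shift_topology:
  assumes "finite (arcs E)"
  shows "compact_space (edge_shift_topology E)"
proof -
  have "compact_space (product_topology (\<lambda>_::nat. discrete_topology (arcs E)) UNIV)"
    using assms by (simp add: compact_space_product_topology compact_space_discrete_topology)
  then show ?thesis
    unfolding edge_shift_topology_def
    using closedin_compact_space closedin_edge_shift compact_space_subtopology by blast
qed

lemma Hausdorff_space_edge_shift_topology: "Hausdorff_space (edge_shift_topology E)"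
  unfolding edge_shift_topology_def
  by (intro Hausdorff_space_subtopology) (simp add: Hausdorff_space_product_topology)

lemma openin_edge_shift_iff:
  "openin (edge_shift_topology E) U \<longleftrightarrow>
     U \<subseteq> edge_shift E \<and>
     (\<forall>x\<in>U. \<exists>n. \<forall>y\<in>edge_shift E. edge_prefix n x = edge_prefix n y \<longrightarrow> y \<in> U)"
proof
  assume "openin (edge_shift_topology E) U"
  then obtain S where "openin (product_topology (\<lambda>_. discrete_topology (arcs E)) UNIV) S"
    "U = S \<inter> edge_shift E"
    by (auto simp: edge_shift_topology_def openin_subtopology)
  then show "U \<subseteq> edge_shift E \<and>
     (\<forall>x\<in>U. \<exists>n. \<forall>y\<in>edge_shift E. edge_prefix n x = edge_prefix n y \<longrightarrow> y \<in> U)"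
    using edge_shift_subset_sequences[of E] unfolding openin_sequences_iff
    by (meson IntD1 IntD2 IntI Int_lower2 subsetD)
next
  assume U: "U \<subseteq> edge_shift E \<and>
     (\<forall>x\<in>U. \<exists>n. \<forall>y\<in>edge_shift E. edge_prefix n x = edge_prefix n y \<longrightarrow> y \<in> U)"
  then obtain n where n: "\<And>x y. x \<in> U \<Longrightarrow> y \<in> edge_shift E \<Longrightarrow>
      edge_prefix (n x) x = edge_prefix (n x) y \<Longrightarrow> y \<in> U"
    by metis
  \<comment> \<open>An open set of the product space that cuts out \<open>U\<close>: the union of
    the cylinders given by the levels \<open>n x\<close>.\<close>
  define S where "S = {y \<in> UNIV \<rightarrow> arcs E. \<exists>x\<in>U. edge_prefix (n x) x = edge_prefix (n x) y}"
  have "openin (product_topology (\<lambda>_. discrete_topology (arcs E)) UNIV) S"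
    unfolding openin_sequences_iff
  proof (intro conjI ballI)
    fix y assume "y \<in> S"
    then obtain x where "x \<in> U" "edge_prefix (n x) x = edge_prefix (n x) y" by (auto simp: S_def)
    then show "\<exists>m. \<forall>z\<in>UNIV \<rightarrow> arcs E. edge_prefix m y = edge_prefix m z \<longrightarrow> z \<in> S"
      unfolding S_def by (intro exI[of _ "n x"]) auto
  qed (auto simp: S_def)
  moreover have "U = S \<inter> edge_shift E"
    using U n edge_shift_subset_sequences[of E] by (auto simp: S_def)
  ultimately show "openin (edge_shift_topology E) U"
    by (auto simp: edge_shift_topology_def openin_subtopology)
qed

lemma determined_compl: "determined E n U \<Longrightarrow> determined E n (edge_shift E - U)"
  unfolding determined_def by (metis Diff_iff Diff_subset)

lemma determined_imp_openin: "determined E n U \<Longrightarrow> openin (edge_shift_topology E) U"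
  unfolding openin_edge_shift_iff determined_def by blast

text \<open>For the converse, a clopen set is compact, hence a union of finitely many cylinders,
  whose levels have a common bound.\<close>

lemma cylindrical_iff_clopen:
  assumes "finite (arcs E)"
  shows "cylindrical E U \<longleftrightarrow>
    openin (edge_shift_topology E) U \<and> closedin (edge_shift_topology E) U"
proof
  assume "cylindrical E U"
  then obtain n where "determined E n U" by (auto simp: cylindrical_def)
  then show "openin (edge_shift_topology E) U \<and> closedin (edge_shift_topology E) U"
    using determined_compl determined_imp_openin determined_subset
    by (metis closedin_def topspace_edge_shift_topology)
next
  assume U: "openin (edge_shift_topology E) U \<and> closedin (edge_shift_topology E) U"
  then have compact: "compactin (edge_shift_topology E) U"
    using assms closedin_compact_space compact_space_edge_shift_topology by blast
  obtain n where n: "\<And>x y. x \<in> U \<Longrightarrow> y \<in> edge_shift E \<Longrightarrow>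
      edge_prefix (n x) x = edge_prefix (n x) y \<Longrightarrow> y \<in> U"
    using U unfolding openin_edge_shift_iff by metis
  define Z where "Z x = {y \<in> edge_shift E. edge_prefix (n x) x = edge_prefix (n x) y}" for x
  have UX: "U \<subseteq> edge_shift E" using U openin_edge_shift_iff by blast
  have det: "determined E (n x) (Z x)" for x by (auto simp: determined_def Z_def)
  have "\<exists>\<F>. finite \<F> \<and> \<F> \<subseteq> Z ` U \<and> U \<subseteq> \<Union>\<F>"
    by (rule compactinD[OF compact]) (use UX determined_imp_openin[OF det] in \<open>auto simp: Z_def\<close>)
  then obtain I where I: "finite I" "I \<subseteq> U" "U \<subseteq> (\<Union>x\<in>I. Z x)"
    by (metis finite_subset_image)
  have "Z x \<subseteq> U" if "x \<in> U" for x using n that by (auto simp: Z_def)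
  then have "U = (\<Union>x\<in>I. Z x)" using I by blast
  moreover have "cylindrical E (\<Union>x\<in>I. Z x)"
    using I(1) det by (intro cylindrical_UN) (auto simp: cylindrical_def)
  ultimately show "cylindrical E U" by simp
qed

text \<open>A continuous bijection from a compact space to a Hausdorff space is a homeomorphism, so
  \<open>\<phi>\<close> and its inverse preserve clopen sets, which are the cylindrical
  ones.\<close>

lemma edge_shifts_conjugate_imp_cylindrical:
  assumes "fin_digraph E" "no_sinks E" "fin_digraph F" "no_sinks F" "edge_shifts_conjugate E F"
  obtains \<phi> where "cylindrical_conjugacy E F \<phi>"
    "cylindrical_conjugacy F E (inv_into (edge_shift E) \<phi>)"
proof -
  interpret E: fin_digraph E by (rule assms(1))
  interpret F: fin_digraph F by (rule assms(3))
  obtain \<phi> where cont: "continuous_map (edge_shift_topology E) (edge_shift_topology F) \<phi>"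
    and bij: "bij_betw \<phi> (edge_shift E) (edge_shift F)"
    and comm: "\<And>x. x \<in> edge_shift E \<Longrightarrow> \<phi> (shift_map x) = shift_map (\<phi> x)"
    using assms(5) by (auto simp: edge_shifts_conjugate_def)
  let ?\<psi> = "inv_into (edge_shift E) \<phi>"
  have "homeomorphic_map (edge_shift_topology E) (edge_shift_topology F) \<phi>"
    using bij cont
    by (intro continuous_imp_homeomorphic_map)
      (simp_all add: topspace_edge_shift_topology bij_betw_def compact_space_edge_shift_topology
        Hausdorff_space_edge_shift_topology)
  then have cyl: "cylindrical F (\<phi> ` U) \<longleftrightarrow> cylindrical E U" if "U \<subseteq> edge_shift E" for U
    using that
    by (simp add: cylindrical_iff_clopen homeomorphic_map_openness homeomorphic_map_closedness
        topspace_edge_shift_topology)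
  have "cylindrical_conjugacy E F \<phi>"
    by unfold_locales (use assms bij comm cyl cylindrical_subset in blast)+
  moreover have "cylindrical_conjugacy F E ?\<psi>"
  proof unfold_locales
    show "bij_betw ?\<psi> (edge_shift F) (edge_shift E)" using bij by (rule bij_betw_inv_into)
    show "?\<psi> (shift_map y) = shift_map (?\<psi> y)" if "y \<in> edge_shift F" for y
    proof -
      have "?\<psi> y \<in> edge_shift E" "\<phi> (?\<psi> y) = y"
        using bij that by (auto simp: bij_betw_def inv_into_into f_inv_into_f)
      then have "shift_map y = \<phi> (shift_map (?\<psi> y))" by (simp add: comm)
      then show ?thesis
        using bij edge_shift_shift_map[OF \<open>?\<psi> y \<in> edge_shift E\<close>] by (simp add: bij_betw_def inv_into_f_f)
    qed
    show "cylindrical E (?\<psi> ` V)" if "cylindrical F V" for V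
    proof -
      have V: "V \<subseteq> edge_shift F" using that by (rule cylindrical_subset)
      have "\<phi> ` ?\<psi> ` V = V" using bij V by (metis bij_betw_def image_inv_into_cancel)
      moreover have "?\<psi> ` V \<subseteq> edge_shift E"
        using bij V by (auto simp: bij_betw_def intro!: inv_into_into)
      ultimately show ?thesis using cyl that by metis
    qed
  qed (use assms in auto)
  ultimately show thesis by (rule that)
qed

section \<open>Quotients of a ring by its ideals\<close>

text \<open>Multipliers range over the whole ring. In the free unital algebra these include the
  scalars, as multiples of the empty word, so \<open>left\<close> covers scaling.\<close>

inductive_set ideal_hull :: "'a::ring set \<Rightarrow> 'a set" for R where
  base: "p \<in> R \<Longrightarrow> p \<in> ideal_hull R"
| zero: "0 \<in> ideal_hull R"
| add: "p \<in> ideal_hull R \<Longrightarrow> q \<in> ideal_hull R \<Longrightarrow> p + q \<in> ideal_hull R"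
| uminus: "p \<in> ideal_hull R \<Longrightarrow> - p \<in> ideal_hull R"
| left: "p \<in> ideal_hull R \<Longrightarrow> a * p \<in> ideal_hull R"
| right: "p \<in> ideal_hull R \<Longrightarrow> p * a \<in> ideal_hull R"

lemma ideal_hull_diff: "p \<in> ideal_hull R \<Longrightarrow> q \<in> ideal_hull R \<Longrightarrow> p - q \<in> ideal_hull R"
  using ideal_hull.add[of p R "- q"] ideal_hull.uminus by auto

text \<open>
  A type cannot depend on an ideal, so this type is the product of the quotients by all ideals.
  The quotient by a particular ideal is one of its factors, and the equational reasoning available
  in the type class \<^class>\<open>ring\<close> thereby applies to it.
\<close>

quotient_type (overloaded) 'a ideal_quotients =
  "'a::ring set \<Rightarrow> 'a" / "\<lambda>f g. \<forall>R. f R - g R \<in> ideal_hull R"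
proof (rule equivpI)
  show "reflp (\<lambda>f g :: 'a set \<Rightarrow> 'a. \<forall>R. f R - g R \<in> ideal_hull R)"
    by (simp add: reflp_def ideal_hull.zero)
  show "symp (\<lambda>f g :: 'a set \<Rightarrow> 'a. \<forall>R. f R - g R \<in> ideal_hull R)"
    by (rule sympI) (metis ideal_hull.uminus minus_diff_eq)
  show "transp (\<lambda>f g :: 'a set \<Rightarrow> 'a. \<forall>R. f R - g R \<in> ideal_hull R)"
  proof (rule transpI, rule allI)
    fix f g h :: "'a set \<Rightarrow> 'a" and R
    assume "\<forall>R. f R - g R \<in> ideal_hull R" "\<forall>R. g R - h R \<in> ideal_hull R"
    then have "(f R - g R) + (g R - h R) \<in> ideal_hull R" by (blast intro: ideal_hull.add)
    then show "f R - h R \<in> ideal_hull R" by simp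
  qed
qed

instantiation ideal_quotients :: (ring) ring
begin

lift_definition zero_ideal_quotients :: "'a ideal_quotients" is "\<lambda>_. 0" .

lift_definition plus_ideal_quotients ::
    "'a ideal_quotients \<Rightarrow> 'a ideal_quotients \<Rightarrow> 'a ideal_quotients" is "\<lambda>f g R. f R + g R"
  by (simp add: add_diff_add ideal_hull.add)

lift_definition uminus_ideal_quotients ::
    "'a ideal_quotients \<Rightarrow> 'a ideal_quotients" is "\<lambda>f R. - f R"
  by (subst minus_diff_minus) (blast intro: ideal_hull.uminus)

lift_definition minus_ideal_quotients ::
    "'a ideal_quotients \<Rightarrow> 'a ideal_quotients \<Rightarrow> 'a ideal_quotients" is "\<lambda>f g R. f R - g R"
proof -
  fix f f' g g' :: "'a set \<Rightarrow> 'a" and R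
  assume "\<And>R. f R - f' R \<in> ideal_hull R" "\<And>R. g R - g' R \<in> ideal_hull R"
  then have "(f R - f' R) - (g R - g' R) \<in> ideal_hull R" by (blast intro: ideal_hull_diff)
  then show "f R - g R - (f' R - g' R) \<in> ideal_hull R" by (simp add: algebra_simps)
qed

lift_definition times_ideal_quotients ::
    "'a ideal_quotients \<Rightarrow> 'a ideal_quotients \<Rightarrow> 'a ideal_quotients" is "\<lambda>f g R. f R * g R"
proof -
  fix f f' g g' :: "'a set \<Rightarrow> 'a" and R
  assume "\<And>R. f R - f' R \<in> ideal_hull R" "\<And>R. g R - g' R \<in> ideal_hull R"
  then have "(f R - f' R) * g R + f' R * (g R - g' R) \<in> ideal_hull R"
    by (blast intro: ideal_hull.intros)
  then show "f R * g R - f' R * g' R \<in> ideal_hull R" by (simp add: algebra_simps)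
qed

instance
  by standard (transfer; simp add: algebra_simps ideal_hull.zero)+

end

text \<open>Being 0 in all other factors keeps the map additive and multiplicative, and its kernel
  is exactly \<open>ideal_hull R\<close>.\<close>

lift_definition ideal_class :: "'a::ring set \<Rightarrow> 'a \<Rightarrow> 'a ideal_quotients"
  is "\<lambda>R p S. if S = R then p else 0" .

lemma ideal_class_eq_0_iff: "ideal_class R p = 0 \<longleftrightarrow> p \<in> ideal_hull R"
  by transfer (auto simp: ideal_hull.zero)

locale ring_map = additive h for h :: "'a::ring \<Rightarrow> 'b::ring" +
  assumes mult: "h (x * y) = h x * h y"

lemma ring_map_ideal_class: "ring_map (ideal_class R)"
  by unfold_locales (transfer; simp add: ideal_hull.zero)+

lemma ring_map_comp: "ring_map h \<Longrightarrow> ring_map k \<Longrightarrow> ring_map (h \<circ> k)"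
  by (simp add: ring_map_def ring_map_axioms_def Modules.additive_def)

section \<open>Substitution in free algebras\<close>

lemma pm_scale_eq: "pm_scale c p = Poly_Mapping.single [] c * p"
  by (simp add: pm_scale_def mult_map_scale_conv_mult zero_list_def)

lemma single_Nil_1 [simp]: "Poly_Mapping.single [] 1 = 1"
  by (simp flip: zero_list_def)

lemma poly_mapping_eq_sum_single:
  "p = (\<Sum>w\<in>Poly_Mapping.keys p. Poly_Mapping.single w (Poly_Mapping.lookup p w))"
  by (rule poly_mapping_eqI) (simp add: lookup_sum lookup_single when_def in_keys_iff)

lemma single_mult_single:
  "Poly_Mapping.single u a * Poly_Mapping.single v b =
     (Poly_Mapping.single (u @ v) (a * b) :: 'x list \<Rightarrow>\<^sub>0 'k::field)"
  by (simp add: mult_single plus_list_def)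

lemma single_Nil_commute:
  fixes p :: "'x list \<Rightarrow>\<^sub>0 'k::field"
  shows "p * Poly_Mapping.single [] c = Poly_Mapping.single [] c * p"
  by (subst (1 2) poly_mapping_eq_sum_single[of p])
    (simp add: sum_distrib_left sum_distrib_right single_mult_single mult.commute)

text \<open>The homomorphism of free unital algebras extending \<open>f\<close>;
  \<open>Poly_Mapping.single [] c\<close> is the scalar \<open>c\<close>.\<close>

definition subst :: "('x \<Rightarrow> ('y list \<Rightarrow>\<^sub>0 'k::field)) \<Rightarrow> ('x list \<Rightarrow>\<^sub>0 'k) \<Rightarrow> ('y list \<Rightarrow>\<^sub>0 'k)" where
  "subst f p = (\<Sum>w\<in>Poly_Mapping.keys p.
     Poly_Mapping.single [] (Poly_Mapping.lookup p w) * prod_list (map f w))"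

lemma subst_superset:
  assumes "finite A" "Poly_Mapping.keys p \<subseteq> A"
  shows "subst f p = (\<Sum>w\<in>A. Poly_Mapping.single [] (Poly_Mapping.lookup p w) * prod_list (map f w))"
  unfolding subst_def using assms
  by (intro sum.mono_neutral_left) (auto simp: in_keys_iff)

lemma subst_single:
  "subst f (Poly_Mapping.single w c) = Poly_Mapping.single [] c * prod_list (map f w)"
  by (subst subst_superset[of "{w}"]) auto

lemma subst_gen [simp]: "subst f (gen x) = f x"
  by (simp add: gen_def subst_single)

lemma subst_add: "subst f (p + q) = subst f p + subst f q"
proof -
  let ?A = "Poly_Mapping.keys p \<union> Poly_Mapping.keys q"
  show ?thesis
    using keys_add[of p q]
    by (simp add: subst_superset[of ?A] lookup_add single_add distrib_right sum.distrib)
qed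

lemma additive_subst: "Modules.additive (subst f)"
  by unfold_locales (rule subst_add)

lemma subst_mult:
  fixes p q :: "'x list \<Rightarrow>\<^sub>0 'k::field"
  shows "subst f (p * q) = subst f p * subst f q"
proof -
  have single: "subst f (Poly_Mapping.single u a * Poly_Mapping.single v b) =
      subst f (Poly_Mapping.single u a) * subst f (Poly_Mapping.single v b)" for u v a b
  proof -
    let ?a = "Poly_Mapping.single [] a" and ?b = "Poly_Mapping.single [] b"
    let ?u = "prod_list (map f u)" and ?v = "prod_list (map f v)"
    have "subst f (Poly_Mapping.single u a * Poly_Mapping.single v b) = ?a * ?b * (?u * ?v)"
      by (simp add: single_mult_single subst_single)
    also have "\<dots> = ?a * (?b * ?u) * ?v" by (simp add: mult.assoc)
    \<comment> \<open>Scalars are central, so the second coefficient can cross the image of the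
      first word.\<close>
    also have "?b * ?u = ?u * ?b" by (rule single_Nil_commute[symmetric])
    finally show ?thesis by (simp add: subst_single mult.assoc)
  qed
  let ?S = "\<lambda>p :: 'x list \<Rightarrow>\<^sub>0 'k. (\<Sum>w\<in>Poly_Mapping.keys p. Poly_Mapping.single w (Poly_Mapping.lookup p w))"
  have "subst f (?S p * ?S q) = subst f (?S p) * subst f (?S q)"
    by (simp add: sum_product additive.sum[OF additive_subst] single)
  then show ?thesis by (simp flip: poly_mapping_eq_sum_single)
qed

lemma ring_map_subst: "ring_map (subst f)"
  by (simp add: ring_map_def ring_map_axioms_def additive_subst subst_mult)

lemma subst_scale: "subst f (pm_scale c p) = pm_scale c (subst f p)"
  by (simp add: pm_scale_eq subst_mult subst_single)

lemma subst_diff: "subst f (p - q) = subst f p - subst f q"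
  by (rule additive.diff[OF additive_subst])

lemma free_algebra_0 [simp]: "0 \<in> free_algebra X"
  by (simp add: free_algebra_def)

lemma free_algebra_add: "p \<in> free_algebra X \<Longrightarrow> q \<in> free_algebra X \<Longrightarrow> p + q \<in> free_algebra X"
  using keys_add[of p q] by (fastforce simp: free_algebra_def)

lemma free_algebra_mult: "p \<in> free_algebra X \<Longrightarrow> q \<in> free_algebra X \<Longrightarrow> p * q \<in> free_algebra X"
  using keys_mult[of p q] by (fastforce simp: free_algebra_def plus_list_def)

lemma free_algebra_single_mult:
  assumes "p \<in> free_algebra X"
  shows "Poly_Mapping.single [] c * p \<in> free_algebra X"
proof -
  have "Poly_Mapping.keys (Poly_Mapping.single [] c * p) \<subseteq> Poly_Mapping.keys p"
    using keys_mult[of "Poly_Mapping.single [] c" p] by (auto simp: plus_list_def split: if_splits)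
  then show ?thesis using assms by (auto simp: free_algebra_def)
qed

lemma free_algebra_scale: "p \<in> free_algebra X \<Longrightarrow> pm_scale c p \<in> free_algebra X"
  by (simp add: pm_scale_eq free_algebra_single_mult)

lemma free_algebra_uminus: "p \<in> free_algebra X \<Longrightarrow> - p \<in> free_algebra X"
  by (simp add: free_algebra_def keys_minus)

lemma free_algebra_diff: "p \<in> free_algebra X \<Longrightarrow> q \<in> free_algebra X \<Longrightarrow> p - q \<in> free_algebra X"
  using free_algebra_add[of p X "- q"] free_algebra_uminus by auto

lemma free_algebra_sum: "(\<And>i. i \<in> A \<Longrightarrow> p i \<in> free_algebra X) \<Longrightarrow> sum p A \<in> free_algebra X"
  by (induction A rule: infinite_finite_induct) (auto intro: free_algebra_add)

lemma gen_in_free_algebra: "x \<in> X \<Longrightarrow> gen x \<in> free_algebra X"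
  by (auto simp: free_algebra_def gen_def)

lemma prod_list_in_free_algebra:
  assumes "w \<noteq> []" "\<And>x. x \<in> set w \<Longrightarrow> f x \<in> free_algebra Y"
  shows "prod_list (map f w) \<in> free_algebra Y"
  using assms
  by (induction w rule: list_nonempty_induct) (auto intro: free_algebra_mult)

lemma subst_in_free_algebra:
  assumes "\<And>x. x \<in> X \<Longrightarrow> f x \<in> free_algebra Y" "p \<in> free_algebra X"
  shows "subst f p \<in> free_algebra Y"
  unfolding subst_def using assms
  by (intro free_algebra_sum free_algebra_single_mult prod_list_in_free_algebra)
    (auto simp: free_algebra_def)

lemma prod_list_gen: "prod_list (map gen w) = Poly_Mapping.single w 1"
proof (induction w)
  case (Cons x w)
  then show ?case by (simp add: gen_def single_mult_single)
qed simp

lemma subst_gen_ident: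
  assumes "p \<in> free_algebra X" "\<And>x. x \<in> X \<Longrightarrow> f x = gen x"
  shows "subst f p = p"
proof -
  have "subst f p = (\<Sum>w\<in>Poly_Mapping.keys p. Poly_Mapping.single w (Poly_Mapping.lookup p w))"
    unfolding subst_def
  proof (rule sum.cong[OF refl])
    fix w assume "w \<in> Poly_Mapping.keys p"
    then have "map f w = map gen w" using assms by (auto simp: free_algebra_def)
    then have "prod_list (map f w) = Poly_Mapping.single w 1" by (metis prod_list_gen)
    then show "Poly_Mapping.single [] (Poly_Mapping.lookup p w) * prod_list (map f w) =
        Poly_Mapping.single w (Poly_Mapping.lookup p w)"
      by (simp add: single_mult_single)
  qed
  then show ?thesis by (simp flip: poly_mapping_eq_sum_single)
qed

lemma generated_ideal_uminus: "p \<in> generated_ideal X R \<Longrightarrow> - p \<in> generated_ideal X R"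
  using ideal_scale[of p X R "- 1"] by (simp add: pm_scale_eq single_uminus)

lemma generated_ideal_sum:
  "(\<And>i. i \<in> A \<Longrightarrow> p i \<in> generated_ideal X R) \<Longrightarrow> sum p A \<in> generated_ideal X R"
  by (induction A rule: infinite_finite_induct) (auto intro: ideal_add ideal_zero)

text \<open>Only the empty word contributes a scalar; every other word becomes a product of elements
  of \<open>free_algebra Y\<close>.\<close>

lemma subst_decompose:
  assumes "\<And>x. f x \<in> free_algebra Y"
  obtains c b where "subst f p = Poly_Mapping.single [] c + b" "b \<in> free_algebra Y"
proof -
  have "\<exists>c b. (\<Sum>w\<in>A. Poly_Mapping.single [] (l w) * prod_list (map f w)) =
      Poly_Mapping.single [] c + b \<and> b \<in> free_algebra Y" if fin: "finite A" for A l
    using fin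
  proof (induction A rule: finite_induct)
    case empty
    show ?case by (intro exI[of _ 0]) simp
  next
    case (insert w A)
    then obtain c b where cb: "(\<Sum>w\<in>A. Poly_Mapping.single [] (l w) * prod_list (map f w)) =
      Poly_Mapping.single [] c + b" "b \<in> free_algebra Y" by blast
    show ?case
    proof (cases "w = []")
      case True
      then have "(\<Sum>w\<in>insert w A. Poly_Mapping.single [] (l w) * prod_list (map f w)) =
          Poly_Mapping.single [] (l w + c) + b"
        using insert cb by (simp add: single_add add.assoc)
      then show ?thesis using cb by blast
    next
      case False
      let ?w = "Poly_Mapping.single [] (l w) * prod_list (map f w)"
      have "?w + b \<in> free_algebra Y"
        using False cb assms
        by (intro free_algebra_add free_algebra_single_mult prod_list_in_free_algebra)
      moreover have "(\<Sum>w\<in>insert w A. Poly_Mapping.single [] (l w) * prod_list (map f w)) =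
          Poly_Mapping.single [] c + (?w + b)"
        using insert cb by (simp add: algebra_simps)
      ultimately show ?thesis by blast
    qed
  qed
  from this[of "Poly_Mapping.keys p" "Poly_Mapping.lookup p"] show thesis
    using that by (auto simp: subst_def)
qed

text \<open>
  Killing the generators outside \<open>X\<close> retracts an ideal of the full free unital algebra onto
  \<^const>\<open>generated_ideal\<close>.
\<close>

lemma ideal_hull_imp_generated_ideal:
  assumes R: "R \<subseteq> free_algebra X" and "p \<in> ideal_hull R" and p: "p \<in> free_algebra X"
  shows "p \<in> generated_ideal X R"
proof -
  define \<rho> where "\<rho> = subst (\<lambda>x. if x \<in> X then gen x else 0 :: 'a list \<Rightarrow>\<^sub>0 'b)"
  have ident: "\<rho> q = q" if "q \<in> free_algebra X" for q
    unfolding \<rho>_def using that by (rule subst_gen_ident) simp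
  have decompose: "\<exists>c b. \<rho> a = Poly_Mapping.single [] c + b \<and> b \<in> free_algebra X" for a
    unfolding \<rho>_def by (rule subst_decompose[of _ X a]) (auto simp: gen_in_free_algebra)
  have "\<rho> p \<in> generated_ideal X R"
    using assms(2)
  proof induction
    case (base p)
    then have "\<rho> p = p" using R ident by blast
    then show ?case using base by (simp add: ideal_base)
  next
    case zero
    show ?case by (simp add: \<rho>_def additive.zero[OF additive_subst] ideal_zero)
  next
    case (add p q)
    then show ?case by (simp add: \<rho>_def subst_add ideal_add)
  next
    case (uminus p)
    then show ?case
      by (simp add: \<rho>_def additive.minus[OF additive_subst] generated_ideal_uminus)
  next
    case (left p a)
    \<comment> \<open>The scalar part of the multiplier is absorbed by \<open>ideal_scale\<close>,
      the rest by \<open>ideal_left\<close>.\<close>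
    obtain c b where "\<rho> a = Poly_Mapping.single [] c + b" "b \<in> free_algebra X" using decompose by blast
    then show ?case
      using left.IH ideal_scale[of "\<rho> p" X R c]
      by (simp add: \<rho>_def subst_mult distrib_right pm_scale_eq ideal_add ideal_left)
  next
    case (right p a)
    obtain c b where "\<rho> a = Poly_Mapping.single [] c + b" "b \<in> free_algebra X" using decompose by blast
    then show ?case
      using right.IH ideal_scale[of "\<rho> p" X R c]
      by (simp add: \<rho>_def subst_mult distrib_left pm_scale_eq single_Nil_commute ideal_add ideal_right)
  qed
  then show ?thesis using p ident by simp
qed

section \<open>Isomorphisms of presented algebras\<close>

lemma equiv_relation_cong: "equiv (free_algebra X) (relation_cong X R)"
proof (rule equivI)
  show "relation_cong X R \<subseteq> free_algebra X \<times> free_algebra X" by (auto simp: relation_cong_def)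
  show "refl_on (free_algebra X) (relation_cong X R)"
    by (auto simp: refl_on_def relation_cong_def ideal_zero)
  show "sym (relation_cong X R)"
    using generated_ideal_uminus by (fastforce simp: sym_def relation_cong_def)
  show "trans (relation_cong X R)"
  proof (rule transI)
    fix p q r assume "(p, q) \<in> relation_cong X R" "(q, r) \<in> relation_cong X R"
    then show "(p, r) \<in> relation_cong X R"
      using ideal_add[of "p - q" X R "q - r"] by (auto simp: relation_cong_def)
  qed
qed

lemma relation_cong_class_eq:
  assumes "(p, q) \<in> relation_cong X R"
  shows "relation_cong X R `` {p} = relation_cong X R `` {q}"
  using assms equiv_relation_cong equiv_class_eq by metis

lemma presented_algebra_add:
  assumes "p \<in> free_algebra X" "q \<in> free_algebra X"
  shows "alg_add (presented_algebra X R) (relation_cong X R `` {p}) (relation_cong X R `` {q}) =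
    relation_cong X R `` {p + q}"
proof -
  have "congruent2 (relation_cong X R) (relation_cong X R) (\<lambda>p q. relation_cong X R `` {p + q})"
  proof (rule congruent2I')
    fix p p' q q' assume "(p, p') \<in> relation_cong X R" "(q, q') \<in> relation_cong X R"
    then show "relation_cong X R `` {p + q} = relation_cong X R `` {p' + q'}"
      using ideal_add[of "p - p'" X R "q - q'"]
      by (intro relation_cong_class_eq) (auto simp: relation_cong_def free_algebra_add algebra_simps)
  qed
  from UN_equiv_class2[OF equiv_relation_cong equiv_relation_cong this assms]
  show ?thesis by (simp add: presented_algebra_def Let_def)
qed

lemma presented_algebra_mult:
  assumes "p \<in> free_algebra X" "q \<in> free_algebra X"
  shows "alg_mult (presented_algebra X R) (relation_cong X R `` {p}) (relation_cong X R `` {q}) =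
    relation_cong X R `` {p * q}"
proof -
  have "congruent2 (relation_cong X R) (relation_cong X R) (\<lambda>p q. relation_cong X R `` {p * q})"
  proof (rule congruent2I')
    fix p p' q q' assume *: "(p, p') \<in> relation_cong X R" "(q, q') \<in> relation_cong X R"
    then have "(p - p') * q + p' * (q - q') \<in> generated_ideal X R"
      by (auto simp: relation_cong_def intro: ideal_add ideal_left ideal_right)
    then show "relation_cong X R `` {p * q} = relation_cong X R `` {p' * q'}"
      using * by (intro relation_cong_class_eq)
        (auto simp: relation_cong_def free_algebra_mult algebra_simps)
  qed
  from UN_equiv_class2[OF equiv_relation_cong equiv_relation_cong this assms]
  show ?thesis by (simp add: presented_algebra_def Let_def)
qed

lemma presented_algebra_scale:
  assumes "p \<in> free_algebra X"
  shows "alg_scale (presented_algebra X R) c (relation_cong X R `` {p}) =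
    relation_cong X R `` {pm_scale c p}"
proof -
  have "congruent (relation_cong X R) (\<lambda>p. relation_cong X R `` {pm_scale c p})"
  proof (rule congruentI)
    fix p p' assume "(p, p') \<in> relation_cong X R"
    then show "relation_cong X R `` {pm_scale c p} = relation_cong X R `` {pm_scale c p'}"
      using ideal_scale[of "p - p'" X R c]
      by (intro relation_cong_class_eq)
        (auto simp: relation_cong_def free_algebra_scale pm_scale_eq algebra_simps
          intro: free_algebra_single_mult)
  qed
  from UN_equiv_class[OF equiv_relation_cong this assms]
  show ?thesis by (simp add: presented_algebra_def Let_def)
qed

lemma alg_carrier_presented_algebra:
  "alg_carrier (presented_algebra X R) = (\<lambda>p. relation_cong X R `` {p}) ` free_algebra X"
  by (auto simp: presented_algebra_def quotient_def Let_def)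

lemma subst_generated_ideal:
  assumes "p \<in> generated_ideal X R" "\<And>x. x \<in> X \<Longrightarrow> f x \<in> free_algebra Y"
    and "\<And>r. r \<in> R \<Longrightarrow> subst f r \<in> generated_ideal Y S"
  shows "subst f p \<in> generated_ideal Y S"
  using assms(1)
proof induction
  case ideal_zero
  show ?case by (simp add: additive.zero[OF additive_subst] generated_ideal.ideal_zero)
qed (auto simp: assms(3) subst_add subst_scale subst_mult
    intro: generated_ideal.intros subst_in_free_algebra[OF assms(2)])

definition subst_class ::
  "'y set \<Rightarrow> ('y list \<Rightarrow>\<^sub>0 'k) set \<Rightarrow> ('x \<Rightarrow> ('y list \<Rightarrow>\<^sub>0 'k::field)) \<Rightarrow>
     ('x list \<Rightarrow>\<^sub>0 'k) set \<Rightarrow> ('y list \<Rightarrow>\<^sub>0 'k) set" where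
  "subst_class Y S f A = (\<Union>p\<in>A. relation_cong Y S `` {subst f p})"

lemma subst_class:
  assumes "\<And>x. x \<in> X \<Longrightarrow> f x \<in> free_algebra Y"
    and "\<And>r. r \<in> R \<Longrightarrow> subst f r \<in> generated_ideal Y S"
    and "p \<in> free_algebra X"
  shows "subst_class Y S f (relation_cong X R `` {p}) = relation_cong Y S `` {subst f p}"
proof -
  have "congruent (relation_cong X R) (\<lambda>p. relation_cong Y S `` {subst f p})"
  proof (rule congruentI)
    fix p q assume "(p, q) \<in> relation_cong X R"
    then show "relation_cong Y S `` {subst f p} = relation_cong Y S `` {subst f q}"
      using subst_generated_ideal[OF _ assms(1,2), of "p - q"] subst_in_free_algebra[OF assms(1)]
      by (intro relation_cong_class_eq) (auto simp: relation_cong_def subst_diff)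
  qed
  from UN_equiv_class[OF equiv_relation_cong this assms(3)]
  show ?thesis by (simp add: subst_class_def)
qed

text \<open>Agreement on generators modulo the ideal passes to words by telescoping and to all
  elements by linearity.\<close>

lemma subst_subst_cong:
  assumes f: "\<And>x. x \<in> X \<Longrightarrow> f x \<in> free_algebra Y" and g: "\<And>y. y \<in> Y \<Longrightarrow> g y \<in> free_algebra X"
    and gf: "\<And>x. x \<in> X \<Longrightarrow> subst g (f x) - gen x \<in> generated_ideal X R"
    and p: "p \<in> free_algebra X"
  shows "(subst g (subst f p), p) \<in> relation_cong X R"
proof -
  have word: "subst g (prod_list (map f w)) - prod_list (map gen w) \<in> generated_ideal X R"
    if "w \<noteq> []" "set w \<subseteq> X" for w
    using that
  proof (induction w rule: list_nonempty_induct)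
    case (single x)
    then show ?case using gf by simp
  next
    case (cons x w)
    let ?a = "subst g (f x)" and ?b = "subst g (prod_list (map f w))"
    have "?b \<in> free_algebra X"
      using cons f by (intro subst_in_free_algebra[OF g] prod_list_in_free_algebra) auto
    moreover have "gen x \<in> free_algebra X" using cons by (simp add: gen_in_free_algebra)
    \<comment> \<open>The sum telescopes to
      \<open>?a * ?b - gen x * prod_list (map gen w)\<close>.\<close>
    ultimately have "(?a - gen x) * ?b + gen x * (?b - prod_list (map gen w)) \<in> generated_ideal X R"
      using cons gf by (auto intro: ideal_add ideal_left ideal_right)
    then show ?case by (simp add: subst_mult algebra_simps)
  qed
  have "subst g (subst f p) - subst gen p = (\<Sum>w\<in>Poly_Mapping.keys p.
      pm_scale (Poly_Mapping.lookup p w) (subst g (prod_list (map f w)) - prod_list (map gen w)))"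
    by (simp add: subst_def[of f] subst_def[of gen] additive.sum[OF additive_subst] subst_mult
        subst_single pm_scale_eq right_diff_distrib sum_subtractf)
  also have "\<dots> \<in> generated_ideal X R"
    using p by (intro generated_ideal_sum ideal_scale word) (auto simp: free_algebra_def)
  finally have "subst g (subst f p) - p \<in> generated_ideal X R"
    using subst_gen_ident[OF p, of gen] by simp
  then show ?thesis
    using subst_in_free_algebra[OF g subst_in_free_algebra[OF f p]] p
    by (simp add: relation_cong_def)
qed

text \<open>By \<open>R\<close> and \<open>S\<close> the substitutions descend to the quotients; by
  \<open>gf\<close> and \<open>fg\<close> the induced maps are mutually inverse.\<close>

lemma presented_algebras_isomorphic:
  assumes f: "\<And>x. x \<in> X \<Longrightarrow> f x \<in> free_algebra Y" and g: "\<And>y. y \<in> Y \<Longrightarrow> g y \<in> free_algebra X"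
    and R: "\<And>r. r \<in> R \<Longrightarrow> subst f r \<in> generated_ideal Y S"
    and S: "\<And>s. s \<in> S \<Longrightarrow> subst g s \<in> generated_ideal X R"
    and gf: "\<And>x. x \<in> X \<Longrightarrow> subst g (f x) - gen x \<in> generated_ideal X R"
    and fg: "\<And>y. y \<in> Y \<Longrightarrow> subst f (g y) - gen y \<in> generated_ideal Y S"
  shows "kalgebras_isomorphic (presented_algebra X R) (presented_algebra Y S)"
proof -
  note f_class = subst_class[OF f R] and g_class = subst_class[OF g S]
  note f_free = subst_in_free_algebra[OF f] and g_free = subst_in_free_algebra[OF g]
  have "bij_betw (subst_class Y S f) (alg_carrier (presented_algebra X R))
      (alg_carrier (presented_algebra Y S))"
    by (rule bij_betw_byWitness[where f' = "subst_class X R g"])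
      (auto simp: alg_carrier_presented_algebra f_class g_class f_free g_free
        relation_cong_class_eq[OF subst_subst_cong[OF f g gf]]
        relation_cong_class_eq[OF subst_subst_cong[OF g f fg]])
  then have "kalgebra_iso (presented_algebra X R) (presented_algebra Y S) (subst_class Y S f)"
    by (auto simp: kalgebra_iso_def alg_carrier_presented_algebra presented_algebra_add
        presented_algebra_mult presented_algebra_scale f_class f_free free_algebra_add
        free_algebra_mult free_algebra_scale subst_add subst_mult subst_scale)
  then show ?thesis by (auto simp: kalgebras_isomorphic_def)
qed

section \<open>Conjugate edge shifts have isomorphic Leavitt path algebras\<close>

context ring_map
begin

lemma path_idem: "h (path_idem E g w) = path_idem E (h \<circ> g) w"
  by (induction w) (simp_all add: sum mult)

lemma cylinder_idem: "h (cylinder_idem E g U) = cylinder_idem E (h \<circ> g) U"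
  by (simp add: cylinder_idem_def sum path_idem)

lemma edge_sum: "h (edge_sum E g) = edge_sum E (h \<circ> g)"
  by (simp add: edge_sum_def sum)

lemma ghost_sum: "h (ghost_sum E g) = ghost_sum E (h \<circ> g)"
  by (simp add: ghost_sum_def sum)

end

text \<open>With the family \<open>g\<close> as a parameter, the same formula can be read in the
  free algebra, at \<open>gen\<close>, and in its quotient; \<open>ring_map.conjugate_family\<close>
  compares the two.\<close>

definition conjugate_family ::
  "('v, 'e) pre_digraph \<Rightarrow> ('w, 'f) pre_digraph \<Rightarrow> ((nat \<Rightarrow> 'e) \<Rightarrow> (nat \<Rightarrow> 'f)) \<Rightarrow>
     (('w, 'f) leavitt_gen \<Rightarrow> 'a::ring) \<Rightarrow> ('v, 'e) leavitt_gen \<Rightarrow> 'a" where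
  "conjugate_family E F \<phi> g =
     shift_generators E (\<lambda>U. cylinder_idem F g (\<phi> ` U)) (edge_sum F g) (ghost_sum F g)"

lemma (in ring_map) conjugate_family:
  "h \<circ> conjugate_family E F \<phi> g = conjugate_family E F \<phi> (h \<circ> g)"
proof
  show "(h \<circ> conjugate_family E F \<phi> g) x = conjugate_family E F \<phi> (h \<circ> g) x" for x
    by (cases x) (simp_all add: conjugate_family_def cylinder_idem edge_sum ghost_sum mult)
qed

context cylindrical_conjugacy
begin

lemma shift_representation_conjugate:
  assumes "leavitt_family F g"
  shows "shift_representation E (\<lambda>U. cylinder_idem F g (\<phi> ` U)) (edge_sum F g) (ghost_sum F g)"
proof -
  interpret leavitt_family F g by (rule assms)
  show ?thesis by (rule shift_representation_pullback) (rule shift_representation_axioms)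
qed

lemma leavitt_family_conjugate:
  "leavitt_family F g \<Longrightarrow> leavitt_family E (conjugate_family E F \<phi> g)"
  unfolding conjugate_family_def
  by (intro shift_representation.leavitt_family_shift_generators shift_representation_conjugate)

lemma cylinder_idem_conjugate:
  "leavitt_family F g \<Longrightarrow> cylindrical E U \<Longrightarrow>
    cylinder_idem E (conjugate_family E F \<phi> g) U = cylinder_idem F g (\<phi> ` U)"
  unfolding conjugate_family_def
  by (rule shift_representation.cylinder_idem_shift_generators[OF shift_representation_conjugate])

lemma edge_sum_conjugate:
  "leavitt_family F g \<Longrightarrow> edge_sum E (conjugate_family E F \<phi> g) = edge_sum F g"
  unfolding conjugate_family_def
  by (rule shift_representation.edge_sum_shift_generators[OF shift_representation_conjugate])

lemma ghost_sum_conjugate: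
  "leavitt_family F g \<Longrightarrow> ghost_sum E (conjugate_family E F \<phi> g) = ghost_sum F g"
  unfolding conjugate_family_def
  by (rule shift_representation.ghost_sum_shift_generators[OF shift_representation_conjugate])

text \<open>Two transfers turn the idempotent of \<open>U\<close> into that of the image of
  \<open>U\<close> under \<open>\<phi>\<close> and then \<open>\<psi>\<close>, which is
  \<open>U\<close>, and keep both sums. So \<open>shift_generators_eq\<close> gives back
  \<open>g\<close>.\<close>

lemma conjugate_family_inverse:
  assumes "cylindrical_conjugacy F E \<psi>" and inv: "\<And>x. x \<in> edge_shift E \<Longrightarrow> \<psi> (\<phi> x) = x"
    and g: "leavitt_family E g" and x: "x \<in> leavitt_gens E"
  shows "conjugate_family E F \<phi> (conjugate_family F E \<psi> g) x = g x"
proof -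
  interpret inverse: cylindrical_conjugacy F E \<psi> by (rule assms(1))
  have "cylinder_idem F (conjugate_family F E \<psi> g) (\<phi> ` U) = cylinder_idem E g U"
    if "cylindrical E U" for U
  proof -
    have "\<psi> ` \<phi> ` U = U"
      using cylindrical_subset[OF that] inv by (force simp: image_image)
    then show ?thesis
      using that by (simp add: inverse.cylinder_idem_conjugate[OF g] cylindrical_image)
  qed
  then have "conjugate_family E F \<phi> (conjugate_family F E \<psi> g) x =
      shift_generators E (cylinder_idem E g) (edge_sum E g) (ghost_sum E g) x"
    by (cases x) (simp_all add: conjugate_family_def[of E] inverse.edge_sum_conjugate[OF g]
        inverse.ghost_sum_conjugate[OF g])
  also have "\<dots> = g x"
    using x leavitt_family.shift_generators_eq[OF g] by (auto simp: leavitt_gens_def)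
  finally show ?thesis .
qed

end

section \<open>The Leavitt family of the generators in the quotient, and the two
  substitutions\<close>

lemma leavitt_gens_intros [intro]:
  "v \<in> verts E \<Longrightarrow> Vertex v \<in> leavitt_gens E"
  "e \<in> arcs E \<Longrightarrow> Edge e \<in> leavitt_gens E"
  "e \<in> arcs E \<Longrightarrow> Ghost e \<in> leavitt_gens E"
  by (auto simp: leavitt_gens_def)

lemma leavitt_relations_in_free_algebra:
  assumes "fin_digraph E"
  shows "leavitt_relations E \<subseteq> free_algebra (leavitt_gens E)"
proof
  interpret fin_digraph E by (rule assms)
  fix r assume "r \<in> leavitt_relations E"
  then show "r \<in> free_algebra (leavitt_gens E)"
    by cases (auto intro!: free_algebra_diff free_algebra_mult free_algebra_sum gen_in_free_algebra)
qed

lemma leavitt_family_ideal_class: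
  assumes "fin_digraph E" "no_sinks E"
  shows "leavitt_family E (ideal_class (leavitt_relations E) \<circ> gen)"
proof -
  interpret fin_digraph E by (rule assms(1))
  interpret q: ring_map "ideal_class (leavitt_relations E)" by (rule ring_map_ideal_class)
  have zero: "ideal_class (leavitt_relations E) r = 0" if "r \<in> leavitt_relations E" for r
    using that by (simp add: ideal_class_eq_0_iff ideal_hull.base)
  have eq: "ideal_class (leavitt_relations E) p = ideal_class (leavitt_relations E) r"
    if "p - r \<in> leavitt_relations E" for p r
    using zero[OF that] by (simp add: q.diff)
  show ?thesis
  proof unfold_locales
    fix v assume v: "v \<in> verts E"
    then have "out_arcs E v \<noteq> {}" using assms(2) by (simp add: no_sinks_def is_sink_def)
    then show "(ideal_class (leavitt_relations E) \<circ> gen) (Vertex v) =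
        (\<Sum>e\<in>out_arcs E v. (ideal_class (leavitt_relations E) \<circ> gen) (Edge e) *
          (ideal_class (leavitt_relations E) \<circ> gen) (Ghost e))"
      using eq[OF vertex_sum[OF v]] finite_out_arcs by (simp add: q.sum q.mult)
  qed (simp_all add: assms(2) eq[OF vertex_idempotent] zero[OF vertex_orthogonal] eq[OF source_edge]
      eq[OF edge_range] eq[OF range_ghost] eq[OF ghost_source] eq[OF ghost_edge_same]
      zero[OF ghost_edge_distinct] flip: q.mult)
qed

lemma ring_map_leavitt_relation:
  assumes "ring_map h" "leavitt_family E (h \<circ> gen)" "r \<in> leavitt_relations E"
  shows "h r = 0"
proof -
  interpret ring_map h by (rule assms(1))
  interpret L: leavitt_family E "h \<circ> gen" by (rule assms(2))
  from assms(3) show ?thesis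
    by cases (use L.vertex_vertex L.vertex_edge L.edge_vertex L.vertex_ghost L.ghost_vertex
        L.ghost_edge L.vertex_sum in \<open>simp_all add: diff mult sum\<close>)
qed

lemma path_idem_in_free_algebra:
  "set w \<subseteq> arcs F \<Longrightarrow> path_idem F gen w \<in> free_algebra (leavitt_gens F)"
  by (induction w)
    (auto intro!: free_algebra_sum free_algebra_mult gen_in_free_algebra)

lemma cylinder_idem_in_free_algebra:
  assumes "cylindrical F U"
  shows "cylinder_idem F gen U \<in> free_algebra (leavitt_gens F)"
  unfolding cylinder_idem_def
  using cylindrical_subset[OF assms] set_edge_prefix
  by (intro free_algebra_sum path_idem_in_free_algebra) blast

context cylindrical_conjugacy
begin

text \<open>In the free algebra \<open>gen\<close> does not obey the Leavitt relations, so the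
  formula only picks representatives; the least level in \<open>cylinder_idem\<close> makes the
  choice definite.\<close>

lemma conjugate_family_in_free_algebra:
  "conjugate_family E F \<phi> gen x \<in> free_algebra (leavitt_gens F)"
  by (cases x) (auto intro!: free_algebra_mult free_algebra_sum cylinder_idem_in_free_algebra
      gen_in_free_algebra cylindrical_image
      simp: conjugate_family_def edge_sum_def ghost_sum_def)

lemma subst_conjugate_family:
  "ideal_class R (subst g (conjugate_family E F \<phi> gen x)) =
     conjugate_family E F \<phi> (ideal_class R \<circ> g) x"
proof -
  have "ring_map (ideal_class R \<circ> subst g)"
    by (intro ring_map_comp ring_map_ideal_class ring_map_subst)
  from fun_cong[OF ring_map.conjugate_family[OF this], of E F \<phi> gen x]
  show ?thesis by (simp add: comp_def)
qed

text \<open>In the quotient the substituted generators form a Leavitt family for \<open>E\<close>,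
  so the relator becomes 0 there, which places its substitution in \<open>ideal_hull\<close>. It
  only involves generators of \<open>F\<close>, so it lies in
  \<open>generated_ideal\<close>.\<close>

lemma subst_leavitt_relation:
  assumes "r \<in> leavitt_relations E"
  shows "subst (conjugate_family E F \<phi> gen) r \<in>
    generated_ideal (leavitt_gens F) (leavitt_relations F)"
proof (rule ideal_hull_imp_generated_ideal)
  let ?q = "ideal_class (leavitt_relations F)" and ?f = "conjugate_family E F \<phi> gen"
  show "leavitt_relations F \<subseteq> free_algebra (leavitt_gens F)"
    by (rule leavitt_relations_in_free_algebra) (rule F.fin_digraph_axioms)
  show "subst ?f r \<in> free_algebra (leavitt_gens F)"
    using assms leavitt_relations_in_free_algebra[OF E.fin_digraph_axioms]
    by (intro subst_in_free_algebra conjugate_family_in_free_algebra) blast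
  have "leavitt_family E (conjugate_family E F \<phi> (?q \<circ> gen))"
    by (intro leavitt_family_conjugate leavitt_family_ideal_class F.fin_digraph_axioms no_sinks_F)
  also have "conjugate_family E F \<phi> (?q \<circ> gen) = (?q \<circ> subst ?f) \<circ> gen"
    by (simp add: fun_eq_iff flip: ring_map.conjugate_family[OF ring_map_ideal_class])
  finally have "(?q \<circ> subst ?f) r = 0"
    by (intro ring_map_leavitt_relation[OF _ _ assms] ring_map_comp ring_map_ideal_class ring_map_subst)
  then show "subst ?f r \<in> ideal_hull (leavitt_relations F)"
    by (simp add: ideal_class_eq_0_iff)
qed

text \<open>Naturality carries both substitutions to the quotient, where the classes of the
  generators form a Leavitt family and \<open>conjugate_family_inverse\<close> applies.\<close>

lemma subst_conjugate_family_inverse: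
  assumes "cylindrical_conjugacy F E \<psi>" "\<And>x. x \<in> edge_shift E \<Longrightarrow> \<psi> (\<phi> x) = x"
    and x: "x \<in> leavitt_gens E"
  shows "subst (conjugate_family F E \<psi> gen) (conjugate_family E F \<phi> gen x) - gen x \<in>
    generated_ideal (leavitt_gens E) (leavitt_relations E)"
proof (rule ideal_hull_imp_generated_ideal)
  interpret inverse: cylindrical_conjugacy F E \<psi> by (rule assms(1))
  interpret q: ring_map "ideal_class (leavitt_relations E)" by (rule ring_map_ideal_class)
  let ?q = "ideal_class (leavitt_relations E)"
  let ?f = "conjugate_family E F \<phi> gen" and ?g = "conjugate_family F E \<psi> gen"
  show "leavitt_relations E \<subseteq> free_algebra (leavitt_gens E)"
    by (rule leavitt_relations_in_free_algebra) (rule E.fin_digraph_axioms)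
  show "subst ?g (?f x) - gen x \<in> free_algebra (leavitt_gens E)"
    using x by (intro free_algebra_diff gen_in_free_algebra
        subst_in_free_algebra[where X = "leavitt_gens F"]
        inverse.conjugate_family_in_free_algebra conjugate_family_in_free_algebra)
  have "?q (subst ?g (?f x)) = conjugate_family E F \<phi> (conjugate_family F E \<psi> (?q \<circ> gen)) x"
    by (simp add: subst_conjugate_family q.conjugate_family)
  also have "\<dots> = (?q \<circ> gen) x"
    by (intro conjugate_family_inverse assms leavitt_family_ideal_class E.fin_digraph_axioms no_sinks_E)
  finally have "?q (subst ?g (?f x) - gen x) = 0"
    by (simp add: q.diff)
  then show "subst ?g (?f x) - gen x \<in> ideal_hull (leavitt_relations E)"
    by (simp add: ideal_class_eq_0_iff)
qed

end

theorem corollary8p19: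
  fixes E :: "('v, 'e) pre_digraph" and F :: "('w, 'f) pre_digraph"
  assumes "fin_digraph E" and "no_sinks E"
    and "fin_digraph F" and "no_sinks F"
    and "edge_shifts_conjugate E F"
  shows "kalgebras_isomorphic
           (leavitt_path_algebra E :: ('k::field, (('v, 'e) leavitt_gen list \<Rightarrow>\<^sub>0 'k) set) kalgebra)
           (leavitt_path_algebra F :: ('k, (('w, 'f) leavitt_gen list \<Rightarrow>\<^sub>0 'k) set) kalgebra)"
proof -
  obtain \<phi> where \<phi>: "cylindrical_conjugacy E F \<phi>"
    and \<psi>: "cylindrical_conjugacy F E (inv_into (edge_shift E) \<phi>)"
    using edge_shifts_conjugate_imp_cylindrical[OF assms] .
  let ?\<psi> = "inv_into (edge_shift E) \<phi>"
  interpret \<phi>: cylindrical_conjugacy E F \<phi> by (rule \<phi>)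
  interpret \<psi>: cylindrical_conjugacy F E ?\<psi> by (rule \<psi>)
  have "?\<psi> (\<phi> x) = x" if "x \<in> edge_shift E" for x
    using that \<phi>.bij by (simp add: bij_betw_def inv_into_f_f)
  moreover have "\<phi> (?\<psi> y) = y" if "y \<in> edge_shift F" for y
    using that \<phi>.bij by (simp add: bij_betw_def f_inv_into_f)
  ultimately show ?thesis
    unfolding leavitt_path_algebra_def
    by (intro presented_algebras_isomorphic[where f = "conjugate_family E F \<phi> gen"
          and g = "conjugate_family F E ?\<psi> gen"]
        \<phi>.conjugate_family_in_free_algebra \<psi>.conjugate_family_in_free_algebra
        \<phi>.subst_leavitt_relation \<psi>.subst_leavitt_relation
        \<phi>.subst_conjugate_family_inverse[OF \<psi>] \<psi>.subst_conjugate_family_inverse[OF \<phi>])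
qed

end
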